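(* Let $U,V\in L^\infty(\mathbb{R})$ be real-valued functions of compact support and let $\{\alpha_\lambda\}_{\lambda>0}$ be positive numbers with $\alpha_\lambda\to+\infty$ as $\lambda\to0$. Let $H_\lambda=-\frac{d^2}{dx^2}+U(x)+\lambda\alpha_\lambda V(\alpha_\lambda x)$ on $W_2^2(\mathbb{R})$ and $H_0=-\frac{d^2}{dx^2}+U$. Suppose $H_0$ has a zero-energy resonance with normalized half-bound state $u$, and let $\theta=\lim_{x\to+\infty}u(x)$. If $$\int_{\mathbb{R}}V\,dx=0,\qquad u(0)u'(0)\int_{\mathbb{R}}xV(x)\,dx<0,$$ and $\alpha_\lambda=o(\lambda^{-1/3})$ as $\lambda\to0$, then $H_\lambda$ has the coupling constant threshold $\lambda=0$, and the threshold eigenvalue satisfies $$e_\lambda=-\frac{\lambda^2}{\alpha_\lambda^2}\left(\Big(\frac{2u(0)u'(0)}{\theta^2+1}\int_{\mathbb{R}}xV(x)\,dx\Big)^2+o(1)\right)\quad\text{as }\lambda\to0.$$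
   Context: $H_0$ possesses a zero-energy resonance if there is a nontrivial solution $h$ of $-h''+Uh=0$ bounded on $\mathbb{R}$ (a half-bound state); its limits $h_\pm=\lim_{x\to\pm\infty}h(x)$ exist and are nonzero, and the normalized half-bound state is $u=h/h_-$ (so $u\to1$ as $x\to-\infty$). The coupling constant threshold $\lambda=0$ means: for all small $\lambda>0$, $H_\lambda$ has a negative eigenvalue $e_\lambda$ with $e_\lambda\to0$ as $\lambda\to0$. *)

theory Defs
  imports "HOL-Analysis.Analysis" "HOL-Library.Landau_Symbols"
begin

text \<open>f is C^1 with derivative f', and f' is locally absolutely continuous
  with a.e. derivative g (g locally integrable).\<close>
definition second_deriv :: "(real \<Rightarrow> real) \<Rightarrow> (real \<Rightarrow> real) \<Rightarrow> (real \<Rightarrow> real) \<Rightarrow> bool" where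
  "second_deriv f f' g \<longleftrightarrow>
     (\<forall>x. (f has_real_derivative f' x) (at x)) \<and>
     (\<forall>a b. set_integrable lborel {a..b} g) \<and>
     (\<forall>x. f' x = f' 0 + (LBINT t=0..x. g t))"

definition square_integrable :: "(real \<Rightarrow> real) \<Rightarrow> bool" where
  "square_integrable f \<longleftrightarrow> f \<in> borel_measurable lborel \<and> integrable lborel (\<lambda>x. (f x)\<^sup>2)"

definition in_W22 :: "(real \<Rightarrow> real) \<Rightarrow> (real \<Rightarrow> real) \<Rightarrow> (real \<Rightarrow> real) \<Rightarrow> bool" where
  "in_W22 f f' g \<longleftrightarrow> second_deriv f f' g \<and> square_integrable f \<and> square_integrable f' \<and> square_integrable g"

definition schr_eigenvalue :: "(real \<Rightarrow> real) \<Rightarrow> real \<Rightarrow> bool" where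
  "schr_eigenvalue W e \<longleftrightarrow> (\<exists>f f' g. in_W22 f f' g \<and> \<not> (AE x in lborel. f x = 0) \<and>
      (AE x in lborel. - g x + W x * f x = e * f x))"

definition half_bound_state :: "(real \<Rightarrow> real) \<Rightarrow> (real \<Rightarrow> real) \<Rightarrow> bool" where
  "half_bound_state U h \<longleftrightarrow> (\<exists>h' g. second_deriv h h' g \<and>
      (AE x in lborel. - g x + U x * h x = 0)) \<and> bounded (range h) \<and> (\<exists>x. h x \<noteq> 0)"

definition Linf_compact :: "(real \<Rightarrow> real) \<Rightarrow> bool" where
  "Linf_compact U \<longleftrightarrow> U \<in> borel_measurable lborel \<and> (\<exists>M. AE x in lborel. \<bar>U x\<bar> \<le> M) \<and>
      (\<exists>R. AE x in lborel. R < \<bar>x\<bar> \<longrightarrow> U x = 0)"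

end

theory Submission
  imports Defs
begin

text \<open>
  At energy \<open>-k\<^sup>2\<close> let \<open>f\<close> be the solution for the potential \<open>U + l a V(a x)\<close> that equals
  \<open>e\<^bsup>k (x + R)\<^esup>\<close> to the left of the supports. Then \<open>-k\<^sup>2\<close> is an eigenvalue if
  \<open>D(k) = f'(R) + k f(R)\<close> vanishes. The Wronskian of \<open>f\<close> with the half-bound state \<open>u\<close>, which is \<open>1\<close>
  on the left and \<open>\<theta>\<close> on the right, gives
  \<open>\<theta> D(k) = k + k \<theta> f(R) + \<integral> (l a V(a x) + k\<^sup>2) u f\<close>. As \<open>l a \<rightarrow> 0\<close>, \<open>f\<close> is \<open>C\<^sup>1\<close>-close to \<open>u\<close>,
  and since \<open>V\<close> has mean zero, \<open>\<integral> l a V(a x) u f = (l / a) (2 u(0) u'(0) \<integral> x V + o(1))\<close>. On the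
  scale \<open>k = s l / a\<close> the function \<open>(a / l) \<theta> D\<close> therefore converges to
  \<open>s (\<theta>\<^sup>2 + 1) + 2 u(0) u'(0) \<integral> x V\<close> for every \<open>s\<close>, and the intermediate value theorem yields a zero
  near the root of this affine function.
\<close>

section \<open>Primitives\<close>

definition primitive_on :: "real set \<Rightarrow> (real \<Rightarrow> 'a::banach) \<Rightarrow> (real \<Rightarrow> 'a) \<Rightarrow> bool" where
  "primitive_on S F f \<longleftrightarrow> (\<forall>x y. x \<le> y \<longrightarrow> {x..y} \<subseteq> S \<longrightarrow> (f has_integral F y - F x) {x..y})"

lemma primitive_onI:
  "(\<And>x y. x \<le> y \<Longrightarrow> {x..y} \<subseteq> S \<Longrightarrow> (f has_integral F y - F x) {x..y}) \<Longrightarrow> primitive_on S F f"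
  by (simp add: primitive_on_def)

lemma primitive_onD:
  "primitive_on S F f \<Longrightarrow> x \<le> y \<Longrightarrow> {x..y} \<subseteq> S \<Longrightarrow> (f has_integral F y - F x) {x..y}"
  by (simp add: primitive_on_def)

lemma primitive_on_subset: "primitive_on S F f \<Longrightarrow> T \<subseteq> S \<Longrightarrow> primitive_on T F f"
  by (auto simp: primitive_on_def)

lemma primitive_on_cong:
  assumes "\<And>x. x \<in> S \<Longrightarrow> F x = G x" "\<And>x. x \<in> S \<Longrightarrow> f x = g x"
  shows "primitive_on S F f \<longleftrightarrow> primitive_on S G g"
proof -
  have "(f has_integral F y - F x) {x..y} \<longleftrightarrow> (g has_integral G y - G x) {x..y}"
    if "x \<le> y" "{x..y} \<subseteq> S" for x y
  proof -
    have "F x = G x" "F y = G y" using that assms(1) by auto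
    moreover have "f t = g t" if "t \<in> {x..y}" for t using that \<open>{x..y} \<subseteq> S\<close> assms(2) by blast
    ultimately show ?thesis using has_integral_cong[of "{x..y}" f g] by simp
  qed
  then show ?thesis unfolding primitive_on_def by blast
qed

lemma primitive_on_join:
  assumes F_left: "primitive_on (S \<inter> {..c}) F f" and F_right: "primitive_on (S \<inter> {c..}) F f"
  shows "primitive_on S F f"
proof (rule primitive_onI)
  fix x y :: real assume xy: "x \<le> y" "{x..y} \<subseteq> S"
  consider (left) "y \<le> c" | (right) "c \<le> x" | (across) "x \<le> c" "c \<le> y" by linarith
  then show "(f has_integral F y - F x) {x..y}"
  proof cases
    case left
    then have "{x..y} \<subseteq> S \<inter> {..c}" using xy by auto
    then show ?thesis by (rule primitive_onD[OF F_left xy(1)])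
  next
    case right
    then have "{x..y} \<subseteq> S \<inter> {c..}" using xy by auto
    then show ?thesis by (rule primitive_onD[OF F_right xy(1)])
  next
    case across
    then have "{x..c} \<subseteq> S \<inter> {..c}" "{c..y} \<subseteq> S \<inter> {c..}" using xy by auto
    then have "(f has_integral F c - F x) {x..c}" "(f has_integral F y - F c) {c..y}"
      using across by (blast intro: primitive_onD[OF F_left] primitive_onD[OF F_right])+
    from has_integral_combine[OF across this] show ?thesis by simp
  qed
qed

lemma primitive_on_diff:
  assumes "primitive_on S F f" "primitive_on S G g"
  shows "primitive_on S (\<lambda>x. F x - G x) (\<lambda>x. f x - g x)"
proof (rule primitive_onI)
  fix x y :: real assume "x \<le> y" "{x..y} \<subseteq> S"
  from has_integral_diff[OF assms[THEN primitive_onD, OF this]]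
  show "((\<lambda>x. f x - g x) has_integral F y - G y - (F x - G x)) {x..y}" by (simp add: algebra_simps)
qed

lemma primitive_on_linear:
  assumes "bounded_linear h" "primitive_on S F f"
  shows "primitive_on S (\<lambda>x. h (F x)) (\<lambda>x. h (f x))"
proof (rule primitive_onI)
  fix x y :: real assume "x \<le> y" "{x..y} \<subseteq> S"
  from has_integral_linear[OF primitive_onD[OF assms(2) this] assms(1)]
  show "((\<lambda>x. h (f x)) has_integral h (F y) - h (F x)) {x..y}"
    by (simp add: o_def linear_simps(2)[OF assms(1)])
qed

lemma primitive_on_Pair:
  assumes "primitive_on S F f" "primitive_on S G g"
  shows "primitive_on S (\<lambda>x. (F x, G x)) (\<lambda>x. (f x, g x))"
proof (rule primitive_onI)
  fix x y :: real assume xy: "x \<le> y" "{x..y} \<subseteq> S"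
  have "((\<lambda>t. (f t, 0) + (0, g t)) has_integral (F y - F x, 0) + (0, G y - G x)) {x..y}"
    using has_integral_linear[OF primitive_onD[OF assms(1) xy]
      bounded_linear_Pair[OF bounded_linear_ident bounded_linear_zero]]
      has_integral_linear[OF primitive_onD[OF assms(2) xy]
        bounded_linear_Pair[OF bounded_linear_zero bounded_linear_ident]]
    unfolding o_def by (rule has_integral_add)
  then show "((\<lambda>t. (f t, g t)) has_integral (F y, G y) - (F x, G x)) {x..y}" by simp
qed

lemma primitive_on_integral:
  assumes f: "f integrable_on {a..b}" and F: "\<And>x. x \<in> {a..b} \<Longrightarrow> F x = C + integral {a..x} f"
  shows "primitive_on {a..b} F f"
proof (rule primitive_onI)
  fix x y assume xy: "x \<le> y" "{x..y} \<subseteq> {a..b}"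
  then have "f integrable_on {a..y}" "f integrable_on {x..y}"
    by (auto intro: integrable_on_subinterval[OF f])
  with Henstock_Kurzweil_Integration.integral_combine[of a x y f] xy
  show "(f has_integral F y - F x) {x..y}" by (simp add: F has_integral_iff algebra_simps)
qed

lemma has_vector_derivative_imp_primitive_on:
  "(\<And>x. x \<in> S \<Longrightarrow> (F has_vector_derivative f x) (at x within S)) \<Longrightarrow> primitive_on S F f"
  by (intro primitive_onI fundamental_theorem_of_calculus)
    (blast intro: has_vector_derivative_within_subset)+

lemma primitive_on_imp_continuous_on_Icc:
  assumes F: "primitive_on S F f" and S: "{a..b} \<subseteq> S"
  shows "continuous_on {a..b} F"
proof (cases "a \<le> b")
  case True
  have "continuous_on {a..b} (\<lambda>x. F a + integral {a..x} f)"
    using primitive_onD[OF F True S] by (intro continuous_intros indefinite_integral_continuous_1) blast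
  moreover have "F a + integral {a..x} f = F x" if "x \<in> {a..b}" for x
    using integral_unique[OF primitive_onD[OF F, of a x]] that S by (auto simp: subset_eq)
  ultimately show ?thesis by (rule continuous_on_eq)
qed simp

lemma primitive_on_imp_isCont:
  assumes "primitive_on UNIV F f"
  shows "isCont F x"
proof -
  have "continuous_on {x - 1..x + 1} F"
    by (rule primitive_on_imp_continuous_on_Icc[OF assms subset_UNIV])
  then show ?thesis by (rule continuous_on_interior) simp
qed

lemma primitive_on_imp_has_vector_derivative:
  assumes F: "primitive_on S F f" and S: "{a..b} \<subseteq> S" and f: "continuous_on {a..b} f"
    and x: "x \<in> {a<..<b}"
  shows "(F has_vector_derivative f x) (at x)"
proof -
  have "((\<lambda>y. F a + integral {a..y} f) has_vector_derivative f x) (at x within {a..b})"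
    using has_vector_derivative_add[OF has_vector_derivative_const
      integral_has_vector_derivative[OF f, of x]] x by simp
  then have "(F has_vector_derivative f x) (at x within {a..b})"
  proof (rule has_vector_derivative_transform[rotated 2])
    show "F y = F a + integral {a..y} f" if "y \<in> {a..b}" for y
      using integral_unique[OF primitive_onD[OF F, of a y]] that S by (auto simp: subset_eq)
  qed (use x in simp)
  then show ?thesis using x by (simp add: at_within_Icc_at)
qed

lemma primitive_on_norm_diff_le:
  assumes F: "primitive_on S F f" and xy: "x \<le> y" "{x..y} \<subseteq> S" and f: "\<And>t. t \<in> {x..y} \<Longrightarrow> norm (f t) \<le> B"
  shows "norm (F y - F x) \<le> B * (y - x)"
proof -
  have "0 \<le> B" using order_trans[OF norm_ge_zero f[of x]] xy(1) by simp
  then show ?thesis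
    using has_integral_bound[of B f "F y - F x" x y] primitive_onD[OF F xy] f xy(1) by simp
qed

lemma primitive_on_zero_imp_eq:
  assumes F: "primitive_on S F f" and S: "is_interval S" and f: "\<And>t. t \<in> S \<Longrightarrow> f t = 0"
    and xy: "x \<in> S" "y \<in> S"
  shows "F y = F x"
proof -
  have ordered: "F v = F u" if uv: "u \<in> S" "v \<in> S" "u \<le> v" for u v
  proof -
    have "{u..v} \<subseteq> S" using interval_subset_is_interval[OF S, of u v] uv by simp
    then have "norm (F v - F u) \<le> 0 * (v - u)"
      using f by (intro primitive_on_norm_diff_le[OF F uv(3)]) auto
    then show ?thesis by simp
  qed
  show ?thesis by (rule linorder_le_cases[OF ordered[OF xy] ordered[OF xy(2,1), symmetric]])
qed

lemma quadratic_increments_imp_eq: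
  fixes D :: "real \<Rightarrow> 'a::real_normed_vector"
  assumes D: "\<And>x y. a \<le> x \<Longrightarrow> x \<le> y \<Longrightarrow> y \<le> b \<Longrightarrow> norm (D y - D x) \<le> K * (y - x)\<^sup>2" and ab: "a \<le> b"
  shows "D b = D a"
proof -
  have sym: "norm (D y - D x) \<le> K * \<bar>y - x\<bar>\<^sup>2" if "x \<in> {a..b}" "y \<in> {a..b}" for x y
    using D[of x y] D[of y x] that by (cases "x \<le> y") (auto simp: norm_minus_commute power2_commute)
  have "(D has_derivative (\<lambda>h. 0)) (at x within {a..b})" if x: "x \<in> {a..b}" for x
    unfolding has_derivative_within
  proof (intro conjI bounded_linear_zero)
    show "((\<lambda>y. (1 / norm (y - x)) *\<^sub>R (D y - (D x + 0))) \<longlongrightarrow> 0) (at x within {a..b})"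
    proof (rule Lim_null_comparison)
      show "\<forall>\<^sub>F y in at x within {a..b}. norm ((1 / norm (y - x)) *\<^sub>R (D y - (D x + 0))) \<le> K * \<bar>y - x\<bar>"
        unfolding eventually_at_filter
        using sym[OF x]
        by (intro always_eventually) (simp add: divide_le_eq power2_eq_square mult.assoc)
      have "((\<lambda>y. K * \<bar>y - x\<bar>) \<longlongrightarrow> K * \<bar>x - x\<bar>) (at x within {a..b})" by (intro tendsto_intros)
      then show "((\<lambda>y. K * \<bar>y - x\<bar>) \<longlongrightarrow> 0) (at x within {a..b})" by simp
    qed
  qed
  then obtain C where "\<And>x. x \<in> {a..b} \<Longrightarrow> D x = C"
    using has_derivative_zero_constant[of "{a..b}" D] by auto
  then show ?thesis using ab by simp
qed

lemma bilinear_frozen_endpoints_bound: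
  fixes prod :: "'a::banach \<Rightarrow> 'b::banach \<Rightarrow> 'c::banach"
  assumes prod: "bounded_bilinear prod" "\<And>x y. norm (prod x y) \<le> norm x * norm y * K" "0 \<le> K"
    and F: "primitive_on {a..b} F f" and G: "primitive_on {a..b} G g"
    and f: "\<And>x. x \<in> {a..b} \<Longrightarrow> norm (f x) \<le> M" and g: "\<And>x. x \<in> {a..b} \<Longrightarrow> norm (g x) \<le> N"
    and t: "t \<in> {a..b}"
  shows "norm ((prod (f t) (G b) + prod (F a) (g t)) - (prod (f t) (G t) + prod (F t) (g t)))
    \<le> 2 * M * N * K * (b - a)"
proof -
  interpret bounded_bilinear prod by (rule prod)
  have M: "0 \<le> M" and N: "0 \<le> N"
    using order_trans[OF norm_ge_zero f[OF t]] order_trans[OF norm_ge_zero g[OF t]] by simp_all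
  have "norm (F t - F a) \<le> M * (t - a)" "norm (G b - G t) \<le> N * (b - t)"
    using t f g by (auto intro!: primitive_on_norm_diff_le[OF F] primitive_on_norm_diff_le[OF G])
  moreover have "M * (t - a) \<le> M * (b - a)" "N * (b - t) \<le> N * (b - a)"
    using t M N by (auto intro: mult_left_mono)
  ultimately have lipschitz: "norm (F t - F a) \<le> M * (b - a)" "norm (G b - G t) \<le> N * (b - a)"
    by linarith+
  have "(prod (f t) (G b) + prod (F a) (g t)) - (prod (f t) (G t) + prod (F t) (g t))
    = prod (f t) (G b - G t) - prod (F t - F a) (g t)"
    by (simp add: diff_left diff_right)
  also have "norm \<dots> \<le> norm (prod (f t) (G b - G t)) + norm (prod (F t - F a) (g t))"
    by (rule norm_triangle_ineq4)
  also have "\<dots> \<le> M * (N * (b - a)) * K + M * (b - a) * N * K"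
    using f[OF t] g[OF t] lipschitz prod(3) M N t
    by (intro add_mono order_trans[OF prod(2)] mult_mono mult_nonneg_nonneg) auto
  finally show ?thesis by (simp add: algebra_simps)
qed

lemma bilinear_primitive_defect_bound:
  fixes prod :: "'a::banach \<Rightarrow> 'b::banach \<Rightarrow> 'c::banach"
  assumes prod: "bounded_bilinear prod" "\<And>x y. norm (prod x y) \<le> norm x * norm y * K" "0 \<le> K"
    and F: "primitive_on {a..b} F f" and G: "primitive_on {a..b} G g"
    and f: "\<And>x. x \<in> {a..b} \<Longrightarrow> norm (f x) \<le> M" and g: "\<And>x. x \<in> {a..b} \<Longrightarrow> norm (g x) \<le> N"
    and int: "(\<lambda>x. prod (f x) (G x) + prod (F x) (g x)) integrable_on {a..b}" and ab: "a \<le> b"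
  shows "norm (prod (F b) (G b) - prod (F a) (G a)
      - integral {a..b} (\<lambda>x. prod (f x) (G x) + prod (F x) (g x)))
    \<le> 2 * M * N * K * (b - a)\<^sup>2"
proof -
  interpret bounded_bilinear prod by (rule prod)
  let ?h = "\<lambda>x. prod (f x) (G x) + prod (F x) (g x)"
  have M: "0 \<le> M" and N: "0 \<le> N"
    using order_trans[OF norm_ge_zero f[of a]] order_trans[OF norm_ge_zero g[of a]] ab by auto
  have pointwise: "norm ((prod (f t) (G b) + prod (F a) (g t)) - ?h t) \<le> 2 * M * N * K * (b - a)"
    if "t \<in> {a..b}" for t
    using bilinear_frozen_endpoints_bound[OF prod F G f g that] by simp
  have "((\<lambda>t. prod (f t) (G b)) has_integral prod (F b - F a) (G b)) {a..b}"
    "((\<lambda>t. prod (F a) (g t)) has_integral prod (F a) (G b - G a)) {a..b}"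
    using has_integral_linear[OF primitive_onD[OF F ab] bounded_linear_left]
      has_integral_linear[OF primitive_onD[OF G ab] bounded_linear_right] by (simp_all add: o_def)
  then have "((\<lambda>t. (prod (f t) (G b) + prod (F a) (g t)) - ?h t) has_integral
      (prod (F b - F a) (G b) + prod (F a) (G b - G a)) - integral {a..b} ?h) {a..b}"
    by (intro has_integral_diff has_integral_add integrable_integral int)
  then have "((\<lambda>t. (prod (f t) (G b) + prod (F a) (g t)) - ?h t) has_integral
      prod (F b) (G b) - prod (F a) (G a) - integral {a..b} ?h) {a..b}"
    by (simp add: diff_left diff_right)
  from has_integral_bound[OF _ this[folded box_real(2)], of "2 * M * N * K * (b - a)"]
    pointwise M N prod(3) ab
  show ?thesis by (simp add: power2_eq_square mult.assoc)
qed

text \<open>The library's integration by parts needs derivatives off a finite set, which bounded measurable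
  potentials do not provide. Here the defect over \<open>[x, y]\<close> is \<open>O((y - x)\<^sup>2)\<close>, hence zero.\<close>

lemma primitive_on_bilinear:
  fixes prod :: "'a::banach \<Rightarrow> 'b::banach \<Rightarrow> 'c::banach"
  assumes prod: "bounded_bilinear prod"
    and F: "primitive_on {a..b} F f" and G: "primitive_on {a..b} G g"
    and f: "\<And>x. x \<in> {a..b} \<Longrightarrow> norm (f x) \<le> M" and g: "\<And>x. x \<in> {a..b} \<Longrightarrow> norm (g x) \<le> N"
    and int: "(\<lambda>x. prod (f x) (G x) + prod (F x) (g x)) integrable_on {a..b}"
  shows "primitive_on {a..b} (\<lambda>x. prod (F x) (G x)) (\<lambda>x. prod (f x) (G x) + prod (F x) (g x))"
proof (rule primitive_onI)
  let ?h = "\<lambda>x. prod (f x) (G x) + prod (F x) (g x)"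
  obtain K where K: "0 \<le> K" "\<And>x y. norm (prod x y) \<le> norm x * norm y * K"
    using bounded_bilinear.nonneg_bounded[OF prod] by blast
  fix c d :: real assume cd: "c \<le> d" "{c..d} \<subseteq> {a..b}"
  have int': "?h integrable_on {x..y}" if "c \<le> x" "y \<le> d" for x y
    using int by (rule integrable_on_subinterval) (use that cd in auto)
  define D where "D x = prod (F x) (G x) - integral {c..x} ?h" for x
  have "norm (D y - D x) \<le> 2 * M * N * K * (y - x)\<^sup>2" if xy: "c \<le> x" "x \<le> y" "y \<le> d" for x y
  proof -
    have sub: "{x..y} \<subseteq> {a..b}" using xy cd by auto
    have "integral {c..x} ?h + integral {x..y} ?h = integral {c..y} ?h"
      using Henstock_Kurzweil_Integration.integral_combine[of c x y ?h] int'[of c y] xy by simp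
    then have "D y - D x = prod (F y) (G y) - prod (F x) (G x) - integral {x..y} ?h"
      by (simp add: D_def algebra_simps)
    then show ?thesis
      using bilinear_primitive_defect_bound[OF prod K(2,1) F[THEN primitive_on_subset, OF sub]
          G[THEN primitive_on_subset, OF sub] _ _ int'[of x y], of M N] f g xy sub by auto
  qed
  then have "D d = D c" using cd(1) by (rule quadratic_increments_imp_eq)
  then show "(?h has_integral prod (F d) (G d) - prod (F c) (G c)) {c..d}"
    using int'[of c d] by (simp add: D_def has_integral_iff algebra_simps)
qed

section \<open>Integral equations\<close>

lemma norm_integral_le_exp:
  fixes h :: "real \<Rightarrow> 'a::banach"
  assumes h: "h integrable_on {a..x}" and le: "\<And>t. t \<in> {a..x} \<Longrightarrow> norm (h t) \<le> K * exp (c * (t - a))"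
    and c: "0 < c" and ax: "a \<le> x"
  shows "norm (integral {a..x} h) \<le> K / c * exp (c * (x - a))"
proof -
  have K: "0 \<le> K" using order_trans[OF norm_ge_zero le[of a]] ax by simp
  have exp: "((\<lambda>t. K * exp (c * (t - a)))
    has_integral K / c * exp (c * (x - a)) - K / c * exp (c * (a - a))) {a..x}"
    using ax c
    by (intro fundamental_theorem_of_calculus)
      (auto intro!: derivative_eq_intros simp: has_real_derivative_iff_has_vector_derivative[symmetric])
  have "norm (integral {a..x} h) \<le> integral {a..x} (\<lambda>t. K * exp (c * (t - a)))"
    using h le exp by (intro Henstock_Kurzweil_Integration.integral_norm_bound_integral) auto
  also have "\<dots> = K / c * exp (c * (x - a)) - K / c" using integral_unique[OF exp] by simp
  also have "\<dots> \<le> K / c * exp (c * (x - a))" using K c by simp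
  finally show ?thesis .
qed

definition weighted_picard ::
  "(real \<Rightarrow> 'a::banach \<Rightarrow> 'a) \<Rightarrow> real \<Rightarrow> real \<Rightarrow> 'a \<Rightarrow> (real \<Rightarrow> 'a) \<Rightarrow> real \<Rightarrow> 'a" where
  "weighted_picard G L a y0 z x =
     exp (- (2 * L * (x - a))) *\<^sub>R (y0 + integral {a..x} (\<lambda>t. G t (exp (2 * L * (t - a)) *\<^sub>R z t)))"

lemma weighted_picard_integrable:
  fixes G :: "real \<Rightarrow> 'a::banach \<Rightarrow> 'a"
  assumes int: "\<And>y. continuous_on {a..b} y \<Longrightarrow> (\<lambda>t. G t (y t)) integrable_on {a..b}"
    and z: "continuous_on {a..b} z" and x: "x \<in> {a..b}"
  shows "(\<lambda>t. G t (exp (c * (t - a)) *\<^sub>R z t)) integrable_on {a..x}"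
proof -
  have "(\<lambda>t. G t (exp (c * (t - a)) *\<^sub>R z t)) integrable_on {a..b}"
    by (intro int continuous_intros z)
  then show ?thesis by (rule integrable_on_subinterval) (use x in auto)
qed

text \<open>The exponential weight makes the Picard operator a contraction of the sup norm,
  whatever the length of the interval.\<close>

lemma weighted_picard_contraction:
  fixes G :: "real \<Rightarrow> 'a::banach \<Rightarrow> 'a"
  assumes lip: "\<And>t y z. norm (G t y - G t z) \<le> L * norm (y - z)" and L: "0 < L"
    and int: "\<And>y. continuous_on {a..b} y \<Longrightarrow> (\<lambda>t. G t (y t)) integrable_on {a..b}"
    and v: "continuous_on {a..b} v" and w: "continuous_on {a..b} w"
    and d: "\<And>t. t \<in> {a..b} \<Longrightarrow> norm (v t - w t) \<le> d" and x: "x \<in> {a..b}"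
  shows "norm (weighted_picard G L a y0 v x - weighted_picard G L a y0 w x) \<le> d / 2"
proof -
  define E where "E t = exp (2 * L * (t - a))" for t
  have E: "0 < E t" for t by (simp add: E_def)
  let ?h = "\<lambda>t. G t (E t *\<^sub>R v t) - G t (E t *\<^sub>R w t)"
  have int': "(\<lambda>t. G t (E t *\<^sub>R v t)) integrable_on {a..x}"
    "(\<lambda>t. G t (E t *\<^sub>R w t)) integrable_on {a..x}"
    using weighted_picard_integrable[OF int v x] weighted_picard_integrable[OF int w x]
    by (simp_all add: E_def)
  have "norm (integral {a..x} ?h) \<le> L * d / (2 * L) * exp (2 * L * (x - a))"
  proof (rule norm_integral_le_exp)
    fix t assume t: "t \<in> {a..x}"
    have "norm (?h t) \<le> L * norm (E t *\<^sub>R (v t - w t))"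
      using lip[of t "E t *\<^sub>R v t" "E t *\<^sub>R w t"] by (simp add: scaleR_diff_right)
    also have "\<dots> \<le> L * (E t * d)" using L E[of t] d[of t] t x by auto
    finally show "norm (?h t) \<le> L * d * exp (2 * L * (t - a))" by (simp add: E_def mult_ac)
  qed (use L x int' in \<open>auto intro!: integrable_diff\<close>)
  also have "\<dots> = d / 2 * E x" using L by (simp add: E_def)
  finally have "norm (integral {a..x} ?h) \<le> d / 2 * E x" .
  moreover have "weighted_picard G L a y0 v x - weighted_picard G L a y0 w x
    = (1 / E x) *\<^sub>R integral {a..x} ?h"
    using Henstock_Kurzweil_Integration.integral_diff[OF int']
    by (simp add: weighted_picard_def E_def exp_minus inverse_eq_divide flip: scaleR_diff_right)
  ultimately show ?thesis using E[of x] by (simp add: pos_divide_le_eq)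
qed

lemma integral_equation_exists:
  fixes G :: "real \<Rightarrow> 'a::banach \<Rightarrow> 'a"
  assumes lip: "\<And>t y z. norm (G t y - G t z) \<le> L * norm (y - z)" and L: "0 < L" and ab: "a \<le> b"
    and int: "\<And>y. continuous_on {a..b} y \<Longrightarrow> (\<lambda>t. G t (y t)) integrable_on {a..b}"
  obtains y where "y a = y0" "primitive_on {a..b} y (\<lambda>t. G t (y t))"
proof -
  let ?P = "\<lambda>z :: real \<Rightarrow>\<^sub>C 'a. weighted_picard G L a y0 z"
  have cont: "continuous_on {a..b} (?P z)" for z
    unfolding weighted_picard_def using ab
    by (intro continuous_intros indefinite_integral_continuous_1
        weighted_picard_integrable[OF int continuous_on_apply_bcontfun]) auto
  have "\<exists>w :: real \<Rightarrow>\<^sub>C 'a. \<forall>x. w x = ?P z (clamp a b x)" for z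
    by (rule continuous_on_cbox_bcontfunE[of a b "?P z"]) (use cont in auto)
  then obtain T where T: "\<And>z x. apply_bcontfun (T z) x = ?P z (clamp a b x)" by metis
  have "dist (T v) (T w) \<le> 1 / 2 * dist v w" for v w
  proof (rule dist_bound)
    fix x
    have x: "clamp a b x \<in> {a..b}" using clamp_in_interval[of a b x] ab by simp
    have "norm (?P v (clamp a b x) - ?P w (clamp a b x)) \<le> dist v w / 2"
    proof (rule weighted_picard_contraction[OF lip L int
          continuous_on_apply_bcontfun continuous_on_apply_bcontfun _ x])
      show "norm (v t - w t) \<le> dist v w" for t using dist_bounded[of v t w] by (simp add: dist_norm)
    qed
    then show "dist (T v x) (T w x) \<le> 1 / 2 * dist v w" unfolding T by (simp add: dist_norm)
  qed
  then obtain z where z: "T z = z" using banach_fix_type[of "1 / 2" T] by auto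
  define y where "y t = exp (2 * L * (t - a)) *\<^sub>R z t" for t
  have y: "y x = y0 + integral {a..x} (\<lambda>t. G t (y t))" if "x \<in> {a..b}" for x
    using T[of z x] that by (simp add: z y_def weighted_picard_def mult_exp_exp)
  show ?thesis
  proof (rule that)
    show "y a = y0" using y[of a] ab by simp
    have "continuous_on {a..b} y"
      unfolding y_def by (intro continuous_intros continuous_on_apply_bcontfun)
    from primitive_on_integral[OF int[OF this] y] show "primitive_on {a..b} y (\<lambda>t. G t (y t))" .
  qed
qed

lemma gronwall:
  fixes w :: "real \<Rightarrow> real"
  assumes w: "continuous_on {a..b} w" and L: "0 \<le> L"
    and le: "\<And>x. x \<in> {a..b} \<Longrightarrow> w x \<le> C + L * integral {a..x} w" and x: "x \<in> {a..b}"
  shows "w x \<le> C * exp (L * (x - a))"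
proof -
  define H where "H x = exp (- L * (x - a)) * (C + L * integral {a..x} w)" for x
  have deriv: "(H has_real_derivative exp (- L * (t - a)) * (L * (w t - (C + L * integral {a..t} w))))
    (at t within {a..b})"
    if "t \<in> {a..b}" for t
    unfolding H_def
    by (rule derivative_eq_intros integral_has_real_derivative[OF w that] refl
        | simp add: algebra_simps)+
  have "H x \<le> H a"
  proof (rule DERIV_nonpos_imp_decreasing_open[where f = H])
    show "a \<le> x" using x by auto
    show "\<exists>y. (H has_real_derivative y) (at t) \<and> y \<le> 0" if "a < t" "t < x" for t
    proof (intro exI conjI)
      show "(H has_real_derivative exp (- L * (t - a))
        * (L * (w t - (C + L * integral {a..t} w)))) (at t)"
        using deriv[of t] that x by (simp add: at_within_Icc_at)
      show "exp (- L * (t - a)) * (L * (w t - (C + L * integral {a..t} w))) \<le> 0"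
        using le[of t] that x L by (intro mult_nonneg_nonpos) auto
    qed
    show "continuous_on {a..x} H"
      using continuous_on_subset[OF DERIV_continuous_on[OF deriv]] x by simp
  qed
  then have "exp (L * (x - a)) * H x \<le> exp (L * (x - a)) * C"
    by (intro mult_left_mono) (auto simp: H_def)
  then have "C + L * integral {a..x} w \<le> C * exp (L * (x - a))"
    by (simp add: H_def mult.assoc[symmetric] mult_exp_exp mult.commute)
  with le[OF x] show ?thesis by simp
qed

lemma primitive_on_gronwall:
  fixes y :: "real \<Rightarrow> 'a::banach"
  assumes y: "primitive_on {a..b} y g" and g: "\<And>t. t \<in> {a..b} \<Longrightarrow> norm (g t) \<le> L * norm (y t) + e"
    and L: "0 \<le> L" and e: "0 \<le> e" and x: "x \<in> {a..b}"
  shows "norm (y x) \<le> (norm (y a) + e * (b - a)) * exp (L * (b - a))"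
proof -
  have cont: "continuous_on {a..b} (\<lambda>t. norm (y t))"
    by (intro continuous_intros primitive_on_imp_continuous_on_Icc[OF y]) simp
  have "norm (y x) \<le> (norm (y a) + e * (b - a)) + L * integral {a..x} (\<lambda>t. norm (y t))"
    if x: "x \<in> {a..b}" for x
  proof -
    have int: "(\<lambda>t. norm (y t)) integrable_on {a..x}"
      by (rule integrable_continuous_real, rule continuous_on_subset[OF cont]) (use x in auto)
    have gx: "(g has_integral y x - y a) {a..x}" using x by (intro primitive_onD[OF y]) auto
    have "norm (y x - y a) \<le> integral {a..x} (\<lambda>t. L * norm (y t) + e)"
      unfolding integral_unique[OF gx, symmetric] using gx int g x
      by (intro Henstock_Kurzweil_Integration.integral_norm_bound_integral integrable_add
        integrable_on_mult_right) auto
    also have "\<dots> = L * integral {a..x} (\<lambda>t. norm (y t)) + e * (x - a)"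
      using int x
      by (subst Henstock_Kurzweil_Integration.integral_add) (auto intro: integrable_on_mult_right)
    also have "\<dots> \<le> L * integral {a..x} (\<lambda>t. norm (y t)) + e * (b - a)"
      using x e by (intro add_left_mono mult_left_mono) auto
    finally show ?thesis using norm_triangle_sub[of "y x" "y a"] by linarith
  qed
  from gronwall[OF cont L this x]
  have "norm (y x) \<le> (norm (y a) + e * (b - a)) * exp (L * (x - a))" .
  also have "\<dots> \<le> (norm (y a) + e * (b - a)) * exp (L * (b - a))"
    using x L e by (intro mult_left_mono) (auto intro: mult_left_mono)
  finally show ?thesis .
qed

section \<open>Schroedinger equations with bounded measurable potentials\<close>

definition bounded_borel :: "(real \<Rightarrow> real) \<Rightarrow> bool" where
  "bounded_borel q \<longleftrightarrow> q \<in> borel_measurable borel \<and> bounded (range q)"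

lemma bounded_borel_measurable: "bounded_borel q \<Longrightarrow> q \<in> borel_measurable borel"
  by (simp add: bounded_borel_def)

lemma bounded_borelE:
  assumes "bounded_borel q"
  obtains M where "0 \<le> M" "\<And>x. \<bar>q x\<bar> \<le> M"
proof -
  obtain M where "\<forall>x. \<bar>q x\<bar> \<le> M" using assms by (auto simp: bounded_borel_def bounded_iff)
  then show ?thesis using that[of M] abs_ge_zero order_trans by blast
qed

lemma bounded_borelI:
  "q \<in> borel_measurable borel \<Longrightarrow> (\<And>x. \<bar>q x\<bar> \<le> M) \<Longrightarrow> bounded_borel q"
  by (auto simp: bounded_borel_def bounded_iff)

lemma bounded_borel_const: "bounded_borel (\<lambda>x. c)"
  by (rule bounded_borelI[of _ "\<bar>c\<bar>"]) auto

lemma bounded_borel_add: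
  assumes "bounded_borel p" "bounded_borel q"
  shows "bounded_borel (\<lambda>x. p x + q x)"
  using assms bounded_plus_comp[of p UNIV q] by (auto simp: bounded_borel_def)

lemma bounded_borel_mult:
  assumes "bounded_borel p" "bounded_borel q"
  shows "bounded_borel (\<lambda>x. p x * q x)"
proof -
  obtain M N where "\<And>x. \<bar>p x\<bar> \<le> M" "\<And>x. \<bar>q x\<bar> \<le> N" using assms by (meson bounded_borelE)
  then have "\<bar>p x * q x\<bar> \<le> M * N" for x
    unfolding abs_mult by (intro mult_mono) (auto intro: order_trans[OF abs_ge_zero])
  then show ?thesis using assms[THEN bounded_borel_measurable] by (intro bounded_borelI) auto
qed

lemma bounded_borel_scale:
  assumes "bounded_borel q"
  shows "bounded_borel (\<lambda>x. q (c * x))"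
proof -
  obtain M where "\<And>x. \<bar>q x\<bar> \<le> M" using assms by (meson bounded_borelE)
  with bounded_borel_measurable[OF assms] show ?thesis by (intro bounded_borelI) auto
qed

lemmas bounded_borel_intros = bounded_borel_const bounded_borel_add bounded_borel_mult
  bounded_borel_scale

lemma set_integrable_bounded_borel_mult:
  assumes q: "bounded_borel q" and f: "set_integrable lborel A f"
  shows "set_integrable lborel A (\<lambda>t. q t * f t)"
proof -
  obtain M where M: "0 \<le> M" "\<And>x. \<bar>q x\<bar> \<le> M" using bounded_borelE[OF q] by blast
  have f': "integrable lborel (\<lambda>t. indicator A t *\<^sub>R f t)" using f by (simp add: set_integrable_def)
  then have "integrable lborel (\<lambda>t. M * (indicator A t *\<^sub>R f t))" by (rule integrable_mult_right)
  moreover have "(\<lambda>t. q t * (indicator A t *\<^sub>R f t)) \<in> borel_measurable lborel"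
    using bounded_borel_measurable[OF q] borel_measurable_integrable[OF f'] by measurable
  moreover have "norm (q t * (indicator A t *\<^sub>R f t)) \<le> norm (M * (indicator A t *\<^sub>R f t))" for t
    using M by (auto simp: abs_mult intro: mult_right_mono)
  ultimately have "integrable lborel (\<lambda>t. q t * (indicator A t *\<^sub>R f t))"
    by (rule Bochner_Integration.integrable_bound[OF _ _ AE_I2])
  then show ?thesis by (simp add: set_integrable_def mult.left_commute)
qed

lemma integrable_on_bounded_borel_mult:
  assumes "bounded_borel q" "continuous_on {a..b} f"
  shows "(\<lambda>t. q t * f t) integrable_on {a..b}"
  using set_integrable_bounded_borel_mult[OF assms(1) borel_integrable_atLeastAtMost'[OF assms(2)]]
  by (rule set_borel_integral_eq_integral(1))

text \<open>Caratheodory solutions of \<open>f'' = q f\<close> with \<open>p = f'\<close>; the second derivative is only ever used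
  through its integrals.\<close>

definition schr_solution :: "(real \<Rightarrow> real) \<Rightarrow> real set \<Rightarrow> (real \<Rightarrow> real) \<Rightarrow> (real \<Rightarrow> real) \<Rightarrow> bool" where
  "schr_solution q S f p \<longleftrightarrow> primitive_on S f p \<and> primitive_on S p (\<lambda>t. q t * f t)"

lemma schr_solutionD:
  assumes "schr_solution q S f p"
  shows "primitive_on S f p" "primitive_on S p (\<lambda>t. q t * f t)"
  using assms by (auto simp: schr_solution_def)

lemma schr_solution_subset: "schr_solution q S f p \<Longrightarrow> T \<subseteq> S \<Longrightarrow> schr_solution q T f p"
  by (auto simp: schr_solution_def intro: primitive_on_subset)

lemma schr_solution_cong:
  assumes "\<And>x. x \<in> S \<Longrightarrow> q x = r x" "\<And>x. x \<in> S \<Longrightarrow> f x = g x" "\<And>x. x \<in> S \<Longrightarrow> p x = s x"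
  shows "schr_solution q S f p \<longleftrightarrow> schr_solution r S g s"
  using primitive_on_cong[of S f g p s]
    primitive_on_cong[of S p s "\<lambda>t. q t * f t" "\<lambda>t. r t * g t"] assms
  by (simp add: schr_solution_def)

lemma schr_solution_join:
  "schr_solution q (S \<inter> {..c}) f p \<Longrightarrow> schr_solution q (S \<inter> {c..}) f p \<Longrightarrow> schr_solution q S f p"
  by (auto simp: schr_solution_def intro: primitive_on_join)

lemma schr_solution_continuous_on:
  assumes "schr_solution q {a..b} f p"
  shows "continuous_on {a..b} f" "continuous_on {a..b} p"
  using schr_solutionD[OF assms] by (auto intro: primitive_on_imp_continuous_on_Icc)

lemma schr_solution_bounded:
  assumes "schr_solution q {a..b} f p"
  shows "bounded (f ` {a..b})" "bounded (p ` {a..b})"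
  using schr_solution_continuous_on[OF assms]
  by (auto intro: compact_imp_bounded compact_continuous_image)

lemma schr_solution_second_derivative_bounded:
  assumes q: "bounded_borel q" and sol: "schr_solution q {a..b} f p"
  shows "bounded ((\<lambda>x. q x * f x) ` {a..b})"
proof -
  obtain M where M: "\<And>x. \<bar>q x\<bar> \<le> M" using q by (meson bounded_borelE)
  obtain N where N: "\<forall>x\<in>{a..b}. \<bar>f x\<bar> \<le> N"
    using schr_solution_bounded(1)[OF sol] by (auto simp: bounded_iff)
  have "norm (q x * f x) \<le> M * N" if "x \<in> {a..b}" for x
    unfolding real_norm_def abs_mult using M N that
    by (intro mult_mono) (auto intro: order_trans[OF abs_ge_zero])
  then show ?thesis unfolding bounded_iff by blast
qed

lemma schr_solution_has_real_derivative:
  assumes "schr_solution q {a..b} f p" "x \<in> {a<..<b}"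
  shows "(f has_real_derivative p x) (at x)"
  using primitive_on_imp_has_vector_derivative[OF schr_solutionD(1)[OF assms(1)] order_refl
      schr_solution_continuous_on(2)[OF assms(1)] assms(2)]
  by (simp add: has_real_derivative_iff_has_vector_derivative)

lemma schr_solution_exp:
  assumes "\<And>x. x \<in> S \<Longrightarrow> q x = k\<^sup>2"
  shows "schr_solution q S (\<lambda>x. A * exp (k * (x - c))) (\<lambda>x. k * (A * exp (k * (x - c))))"
proof -
  have "primitive_on S (\<lambda>x. B * exp (k * (x - c))) (\<lambda>x. k * (B * exp (k * (x - c))))" for B
    by (rule has_vector_derivative_imp_primitive_on)
      (auto simp: has_real_derivative_iff_has_vector_derivative[symmetric] intro!: derivative_eq_intros)
  from this[of A] this[of "k * A"] show ?thesis
    using primitive_on_cong[of S "\<lambda>x. k * (A * exp (k * (x - c)))" _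
      "\<lambda>x. q x * (A * exp (k * (x - c)))"] assms
    by (simp add: schr_solution_def power2_eq_square mult.assoc)
qed

lemma schr_solution_exists:
  assumes q: "bounded_borel q" and ab: "a \<le> b"
  obtains f p where "schr_solution q {a..b} f p" "f a = A" "p a = B"
proof -
  obtain M where M: "0 \<le> M" "\<And>x. \<bar>q x\<bar> \<le> M" using bounded_borelE[OF q] by blast
  define G where "G t y = (snd y, q t * fst y)" for t and y :: "real \<times> real"
  have lip: "norm (G t y - G t z) \<le> (1 + M) * norm (y - z)" for t y z
  proof -
    have "G t y - G t z = (snd (y - z), q t * fst (y - z))" by (simp add: G_def algebra_simps)
    also have "norm \<dots> \<le> norm (snd (y - z)) + norm (q t * fst (y - z))" by (rule norm_Pair_le)
    also have "\<dots> \<le> norm (y - z) + M * norm (y - z)"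
    proof -
      have "norm (fst (y - z)) \<le> norm (y - z)" "norm (snd (y - z)) \<le> norm (y - z)"
        by (metis norm_fst_le prod.collapse) (metis norm_snd_le prod.collapse)
      then show ?thesis unfolding norm_mult using M(1) M(2)[of t] by (intro add_mono mult_mono) simp_all
    qed
    finally show ?thesis by (simp add: algebra_simps)
  qed
  have int: "(\<lambda>t. G t (y t)) integrable_on {a..b}" if "continuous_on {a..b} y" for y
  proof -
    have "continuous_on {a..b} (\<lambda>t. fst (y t))" "continuous_on {a..b} (\<lambda>t. snd (y t))"
      using that by (auto intro: continuous_intros)
    then have "(\<lambda>t. q t * fst (y t)) integrable_on {a..b}" "(\<lambda>t. snd (y t)) integrable_on {a..b}"
      by (auto intro: integrable_on_bounded_borel_mult[OF q] integrable_continuous_real)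
    then have "primitive_on {a..b}
        (\<lambda>x. (integral {a..x} (\<lambda>t. snd (y t)), integral {a..x} (\<lambda>t. q t * fst (y t))))
        (\<lambda>t. G t (y t))"
      unfolding G_def by (intro primitive_on_Pair primitive_on_integral[where C = 0]) auto
    from primitive_onD[OF this ab] show ?thesis by blast
  qed
  obtain y where y: "y a = (A, B)" "primitive_on {a..b} y (\<lambda>t. G t (y t))"
    using integral_equation_exists[OF lip _ ab int] M(1) by auto
  have "schr_solution q {a..b} (\<lambda>x. fst (y x)) (\<lambda>x. snd (y x))"
    using primitive_on_linear[OF bounded_linear_fst y(2)]
      primitive_on_linear[OF bounded_linear_snd y(2)]
    by (simp add: schr_solution_def G_def)
  then show ?thesis by (rule that) (simp_all add: y(1))
qed

lemma schr_solution_stability: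
  assumes sol: "schr_solution q {a..b} f p" "schr_solution r {a..b} g s"
    and q: "\<And>x. \<bar>q x\<bar> \<le> M" and diff: "\<And>x. \<bar>q x - r x\<bar> \<le> d"
    and g: "\<And>x. x \<in> {a..b} \<Longrightarrow> \<bar>g x\<bar> \<le> B" and x: "x \<in> {a..b}"
  shows "norm (f x - g x, p x - s x) \<le>
    (norm (f a - g a, p a - s a) + d * B * (b - a)) * exp ((1 + M) * (b - a))"
proof -
  have M: "0 \<le> M" using q[of 0] by linarith
  have d: "0 \<le> d" using diff[of 0] by linarith
  have B: "0 \<le> B" using g[OF x] by linarith
  have bound: "norm (p t - s t, q t * f t - r t * g t) \<le> (1 + M) * norm (f t - g t, p t - s t) + d * B"
    if t: "t \<in> {a..b}" for t
  proof -
    have "norm (p t - s t, q t * f t - r t * g t)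
      \<le> \<bar>p t - s t\<bar> + \<bar>q t * (f t - g t) + (q t - r t) * g t\<bar>"
      using norm_Pair_le[of "p t - s t" "q t * f t - r t * g t"] by (simp add: algebra_simps)
    also have "\<dots> \<le> \<bar>p t - s t\<bar> + (\<bar>q t\<bar> * \<bar>f t - g t\<bar> + \<bar>q t - r t\<bar> * \<bar>g t\<bar>)"
      unfolding abs_mult[symmetric] by (intro add_left_mono abs_triangle_ineq)
    also have "\<dots> \<le> norm (f t - g t, p t - s t) + (M * norm (f t - g t, p t - s t) + d * B)"
      using norm_fst_le[of "f t - g t" "p t - s t"] norm_snd_le[of "p t - s t" "f t - g t"]
        q[of t] diff[of t] g[OF t] M d by (intro add_mono mult_mono) auto
    finally show ?thesis by (simp add: algebra_simps)
  qed
  have "primitive_on {a..b} (\<lambda>t. (f t - g t, p t - s t)) (\<lambda>t. (p t - s t, q t * f t - r t * g t))"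
    by (intro primitive_on_Pair primitive_on_diff schr_solutionD[OF sol(1)] schr_solutionD[OF sol(2)])
  from primitive_on_gronwall[OF this bound _ _ x] M d B show ?thesis by simp
qed

lemma schr_solution_uniform_limit:
  assumes sol: "schr_solution q {a..b} f p" "\<And>n. schr_solution (Q n) {a..b} (g n) (s n)"
    and q: "bounded_borel q" and diff: "\<And>n x. \<bar>Q n x - q x\<bar> \<le> d n" and d: "(d \<longlongrightarrow> 0) F"
    and init: "((\<lambda>n. g n a) \<longlongrightarrow> f a) F" "((\<lambda>n. s n a) \<longlongrightarrow> p a) F"
  shows "uniform_limit {a..b} g f F" "uniform_limit {a..b} s p F"
proof -
  obtain M where M: "\<And>x. \<bar>q x\<bar> \<le> M" using q by (meson bounded_borelE)
  obtain B where B: "\<forall>x\<in>{a..b}. \<bar>f x\<bar> \<le> B"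
    using schr_solution_bounded(1)[OF sol(1)] by (auto simp: bounded_iff)
  define \<epsilon> where "\<epsilon> n
    = (norm (g n a - f a, s n a - p a) + d n * B * (b - a)) * exp ((1 + (M + d n)) * (b - a))" for n
  have bound: "norm (g n x - f x, s n x - p x) \<le> \<epsilon> n" if "x \<in> {a..b}" for n x
  proof -
    have "\<bar>Q n x\<bar> \<le> M + d n" for x using M[of x] diff[of n x] by linarith
    from schr_solution_stability[OF sol(2,1) this diff B[rule_format] that] show ?thesis
      by (simp add: \<epsilon>_def)
  qed
  have "(\<epsilon> \<longlongrightarrow> (norm (f a - f a, p a - p a) + 0 * B * (b - a)) * exp ((1 + (M + 0)) * (b - a))) F"
    unfolding \<epsilon>_def by (intro tendsto_intros init d)
  then have "(\<epsilon> \<longlongrightarrow> 0) F" by simp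
  then have \<epsilon>: "uniform_limit {a..b} (\<lambda>n x. \<epsilon> n) (\<lambda>x. 0) F" by (simp add: uniform_limit_iff tendsto_iff)
  have "dist (g n x) (f x) \<le> dist (\<epsilon> n) 0" "dist (s n x) (p x) \<le> dist (\<epsilon> n) 0" if "x \<in> {a..b}" for n x
    using order_trans[OF norm_fst_le bound[OF that, of n]]
      order_trans[OF norm_snd_le bound[OF that, of n]]
    by (simp_all add: dist_norm)
  then show "uniform_limit {a..b} g f F" "uniform_limit {a..b} s p F"
    by (auto intro!: metric_uniform_limit_imp_uniform_limit[OF \<epsilon>] always_eventually)
qed

lemma schr_solution_wronskian:
  assumes sol: "schr_solution q {a..b} f p" "schr_solution r {a..b} g s"
    and q: "bounded_borel q" and r: "bounded_borel r"
  shows "primitive_on {a..b} (\<lambda>x. f x * s x - p x * g x) (\<lambda>x. (r x - q x) * (f x * g x))"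
proof -
  obtain C D where CD: "\<forall>x\<in>{a..b}. norm (p x) \<le> C" "\<forall>x\<in>{a..b}. norm (s x) \<le> D"
    using schr_solution_bounded(2)[OF sol(1)] schr_solution_bounded(2)[OF sol(2)]
    by (auto simp: bounded_iff)
  obtain K L where KL: "\<forall>x\<in>{a..b}. norm (q x * f x) \<le> K" "\<forall>x\<in>{a..b}. norm (r x * g x) \<le> L"
    using schr_solution_second_derivative_bounded[OF q sol(1)]
      schr_solution_second_derivative_bounded[OF r sol(2)] by (auto simp: bounded_iff)
  note cont = schr_solution_continuous_on[OF sol(1)] schr_solution_continuous_on[OF sol(2)]
  have ps: "(\<lambda>x. p x * s x) integrable_on {a..b}"
    by (intro integrable_continuous_real continuous_intros cont)
  have int: "(\<lambda>x. q x * (f x * g x)) integrable_on {a..b}"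
    "(\<lambda>x. r x * (f x * g x)) integrable_on {a..b}"
    by (intro integrable_on_bounded_borel_mult q r continuous_intros cont)+
  have "primitive_on {a..b} (\<lambda>x. f x * s x) (\<lambda>x. p x * s x + f x * (r x * g x))"
    using schr_solutionD(1)[OF sol(1)] schr_solutionD(2)[OF sol(2)] CD KL integrable_add[OF ps int(2)]
    by (intro primitive_on_bilinear[OF bounded_bilinear_mult]) (auto simp: mult_ac)
  moreover have "primitive_on {a..b} (\<lambda>x. p x * g x) (\<lambda>x. (q x * f x) * g x + p x * s x)"
    using schr_solutionD(2)[OF sol(1)] schr_solutionD(1)[OF sol(2)] CD KL integrable_add[OF int(1) ps]
    by (intro primitive_on_bilinear[OF bounded_bilinear_mult]) (auto simp: mult_ac)
  ultimately have "primitive_on {a..b} (\<lambda>x. f x * s x - p x * g x)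
      (\<lambda>x. (p x * s x + f x * (r x * g x)) - ((q x * f x) * g x + p x * s x))"
    by (rule primitive_on_diff)
  then show ?thesis by (simp add: algebra_simps)
qed

section \<open>Eigenvalues\<close>

lemma interval_integral_diff_eq_integral:
  fixes g :: "real \<Rightarrow> real"
  assumes g: "\<And>a b. set_integrable lborel {a..b} g" and xy: "x \<le> y"
  shows "(LBINT t=0..y. g t) - (LBINT t=0..x. g t) = integral {x..y} g"
proof -
  have "set_integrable lborel {c<..<d} g" for c d
    by (rule set_integrable_subset[OF g[of c d]]) auto
  then have "interval_lebesgue_integrable lborel (ereal c) (ereal d) g" for c d
    by (simp add: interval_lebesgue_integrable_def)
  from this[of "min 0 (min x y)" "max 0 (max x y)"]
  have "(LBINT t=ereal 0..x. g t) + (LBINT t=x..y. g t) = (LBINT t=ereal 0..y. g t)"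
    by (intro interval_integral_sum) (simp only: ereal_min ereal_max)
  then show ?thesis using interval_integral_eq_integral[OF xy g] by (simp add: zero_ereal_def)
qed

lemma second_deriv_iff_primitive_on:
  "second_deriv f f' g \<longleftrightarrow>
    (\<forall>x. (f has_real_derivative f' x) (at x)) \<and> (\<forall>a b. set_integrable lborel {a..b} g) \<and>
    primitive_on UNIV f' g"
proof -
  have ftc: "(\<forall>x. f' x = f' 0 + (LBINT t=0..x. g t)) \<longleftrightarrow> primitive_on UNIV f' g" (is "?formula \<longleftrightarrow> _")
    if g: "\<And>a b. set_integrable lborel {a..b} g"
  proof -
    have int: "g integrable_on {x..y}" for x y using set_borel_integral_eq_integral(1)[OF g] .
    show ?thesis
    proof
      assume f': ?formula
      have "f' y - f' x = integral {x..y} g" if "x \<le> y" for x y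
        using interval_integral_diff_eq_integral[OF g that] f'[rule_format, of x] f'[rule_format, of y]
        by linarith
      with int show "primitive_on UNIV f' g" by (auto intro!: primitive_onI simp: has_integral_iff)
    next
      assume prim: "primitive_on UNIV f' g"
      have zero: "(LBINT t=0..ereal 0. g t) = 0" by (simp add: zero_ereal_def)
      have diff: "(LBINT t=0..y. g t) - (LBINT t=0..x. g t) = f' y - f' x" if "x \<le> y" for x y
        using interval_integral_diff_eq_integral[OF g that]
          integral_unique[OF primitive_onD[OF prim that]] by simp
      show ?formula
      proof
        fix x :: real
        show "f' x = f' 0 + (LBINT t=0..x. g t)"
          using diff[of 0 x] diff[of x 0] zero by linarith
      qed
    qed
  qed
  show ?thesis unfolding second_deriv_def by (intro conj_cong refl ftc) simp
qed

lemma schr_solution_imp_second_deriv: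
  assumes sol: "schr_solution q UNIV f p" and q: "bounded_borel q"
  shows "second_deriv f p (\<lambda>x. q x * f x)"
  unfolding second_deriv_iff_primitive_on
proof (intro conjI allI)
  have sol': "schr_solution q {a..b} f p" for a b
    by (rule schr_solution_subset[OF sol subset_UNIV])
  show "(f has_real_derivative p x) (at x)" for x
    by (rule schr_solution_has_real_derivative[OF sol'[of "x - 1" "x + 1"]]) simp
  show "set_integrable lborel {a..b} (\<lambda>x. q x * f x)" for a b
    by (rule set_integrable_bounded_borel_mult[OF q borel_integrable_atLeastAtMost'])
      (rule schr_solution_continuous_on(1)[OF sol'])
  show "primitive_on UNIV p (\<lambda>x. q x * f x)" by (rule schr_solutionD(2)[OF sol])
qed

lemma integrable_exp_minus_abs:
  fixes c :: real
  assumes c: "c > 0"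
  shows "integrable lborel (\<lambda>x. exp (- c * \<bar>x\<bar>))"
proof -
  let ?g = "\<lambda>x. indicator {0..} x *\<^sub>R exp (- c * x)"
  have "integrable lebesgue ?g"
    using c by (intro nonnegative_absolutely_integrable_1 [unfolded set_integrable_def]
      integrable_on_exp_minus_to_infinity) auto
  then have g: "integrable lborel ?g" by (subst (asm) integrable_completion) auto
  have "integrable lborel (\<lambda>x. ?g (0 + (-1) * x))" by (rule lborel_integrable_real_affine[OF g]) auto
  then have "integrable lborel (\<lambda>x. ?g x + ?g (0 + (-1) * x))" using g by simp
  then show ?thesis
    by (rule Bochner_Integration.integrable_bound) (auto simp: indicator_def)
qed

lemma square_integrable_exp_decay:
  assumes f: "f \<in> borel_measurable borel" and le: "\<And>x. \<bar>f x\<bar> \<le> C * exp (- k * \<bar>x\<bar>)" and k: "k > 0"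
  shows "square_integrable f"
  unfolding square_integrable_def
proof
  have exp: "integrable lborel (\<lambda>x. C\<^sup>2 * exp (- (2 * k) * \<bar>x\<bar>))"
    using integrable_exp_minus_abs[of "2 * k"] k by simp
  have bound: "norm ((f x)\<^sup>2) \<le> norm (C\<^sup>2 * exp (- (2 * k) * \<bar>x\<bar>))" for x
  proof -
    have "(f x)\<^sup>2 \<le> (C * exp (- k * \<bar>x\<bar>))\<^sup>2" using le[of x]
      by (intro abs_le_square_iff[THEN iffD1]) auto
    also have "\<dots> = C\<^sup>2 * exp (- (2 * k) * \<bar>x\<bar>)"
      by (simp add: power_mult_distrib exp_double[symmetric] algebra_simps)
    finally show ?thesis by simp
  qed
  show "integrable lborel (\<lambda>x. (f x)\<^sup>2)"
    by (rule Bochner_Integration.integrable_bound[OF exp _ AE_I2[OF bound]]) (use f in measurable)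
qed (use f in simp)

lemma continuous_exp_tails_imp_exp_decay:
  fixes f :: "real \<Rightarrow> real"
  assumes f: "\<And>x. isCont f x" and tails: "\<And>x. R \<le> \<bar>x\<bar> \<Longrightarrow> \<bar>f x\<bar> \<le> C * exp (- k * \<bar>x\<bar>)"
  shows "\<exists>D. \<forall>x. \<bar>f x\<bar> \<le> D * exp (- k * \<bar>x\<bar>)"
proof -
  have "bounded ((\<lambda>x. f x * exp (k * \<bar>x\<bar>)) ` {- R..R})"
    using f by (intro compact_imp_bounded compact_continuous_image continuous_intros
      continuous_at_imp_continuous_on) auto
  then obtain B where B: "\<forall>x\<in>{- R..R}. \<bar>f x * exp (k * \<bar>x\<bar>)\<bar> \<le> B" by (auto simp: bounded_iff)
  have "\<bar>f x\<bar> \<le> max B C * exp (- k * \<bar>x\<bar>)" for x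
  proof (cases "R \<le> \<bar>x\<bar>")
    case True
    have "C * exp (- k * \<bar>x\<bar>) \<le> max B C * exp (- k * \<bar>x\<bar>)" by (intro mult_right_mono) auto
    with tails[OF True] show ?thesis by linarith
  next
    case False
    then have "x \<in> {- R..R}" by auto
    then have "\<bar>f x\<bar> * exp (k * \<bar>x\<bar>) \<le> B" using B by (simp add: abs_mult)
    then have "\<bar>f x\<bar> * exp (k * \<bar>x\<bar>) \<le> max B C" by (rule order_trans) simp
    then show ?thesis by (simp add: exp_minus field_simps)
  qed
  then show ?thesis by blast
qed

lemma exp_tails_imp_schr_eigenvalue:
  assumes sol: "schr_solution (\<lambda>x. W x + k\<^sup>2) UNIV f p" and W: "bounded_borel W" and k: "0 < k"
    and f_tails: "\<And>x. R \<le> \<bar>x\<bar> \<Longrightarrow> \<bar>f x\<bar> \<le> C * exp (- k * \<bar>x\<bar>)"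
    and p_tails: "\<And>x. R \<le> \<bar>x\<bar> \<Longrightarrow> \<bar>p x\<bar> \<le> D * exp (- k * \<bar>x\<bar>)" and nz: "f x \<noteq> 0"
  shows "schr_eigenvalue W (- k\<^sup>2)"
proof -
  let ?q = "\<lambda>x. W x + k\<^sup>2"
  have q: "bounded_borel ?q" by (intro bounded_borel_intros W)
  then obtain M where M: "0 \<le> M" "\<And>x. \<bar>?q x\<bar> \<le> M" using bounded_borelE by blast
  have cont: "isCont f x" "isCont p x" for x
    using schr_solutionD[OF sol] by (auto intro: primitive_on_imp_isCont)
  then have meas: "f \<in> borel_measurable borel" "p \<in> borel_measurable borel"
    by (simp_all add: borel_measurable_continuous_onI continuous_at_imp_continuous_on)
  obtain C' D' where decay: "\<bar>f x\<bar> \<le> C' * exp (- k * \<bar>x\<bar>)" "\<bar>p x\<bar> \<le> D' * exp (- k * \<bar>x\<bar>)" for x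
    using continuous_exp_tails_imp_exp_decay[OF cont(1) f_tails]
      continuous_exp_tails_imp_exp_decay[OF cont(2) p_tails]
    by blast
  have decay_q: "\<bar>?q x * f x\<bar> \<le> M * C' * exp (- k * \<bar>x\<bar>)" for x
    using mult_mono[OF M(2)[of x] decay(1)[of x]] M(1) by (simp add: abs_mult mult.assoc)
  have "in_W22 f p (\<lambda>x. ?q x * f x)"
    unfolding in_W22_def
    using schr_solution_imp_second_deriv[OF sol q] square_integrable_exp_decay[OF meas(1) decay(1) k]
      square_integrable_exp_decay[OF meas(2) decay(2) k]
      square_integrable_exp_decay[OF borel_measurable_times[OF bounded_borel_measurable[OF q] meas(1)]
        decay_q k]
    by (intro conjI)
  moreover have "\<not> (AE x in lborel. f x = 0)"
  proof
    assume "AE x in lborel. f x = 0"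
    moreover have "closed {x. f x = 0}"
      using cont(1) by (intro closed_Collect_eq continuous_at_imp_continuous_on) auto
    ultimately have "x \<in> {x. f x = 0}"
      by (intro mem_closed_if_AE_lebesgue) (auto intro: AE_completion)
    with nz show False by simp
  qed
  moreover have "AE x in lborel. - (?q x * f x) + W x * f x = - k\<^sup>2 * f x" by (simp add: algebra_simps)
  ultimately show ?thesis unfolding schr_eigenvalue_def by blast
qed

lemma schr_eigenvalue_cong_AE:
  assumes W: "schr_eigenvalue W e" and eq: "AE x in lborel. W x = W' x"
  shows "schr_eigenvalue W' e"
proof -
  obtain f f' g where f: "in_W22 f f' g" "\<not> (AE x in lborel. f x = 0)"
    "AE x in lborel. - g x + W x * f x = e * f x"
    using W by (auto simp: schr_eigenvalue_def)
  from f(3) eq have "AE x in lborel. - g x + W' x * f x = e * f x" by eventually_elim simp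
  with f(1,2) show ?thesis unfolding schr_eigenvalue_def by blast
qed

lemma schr_solution_glue_exp:
  assumes sol: "schr_solution q {- R..R} f p" and R: "0 < R" and q: "\<And>x. R \<le> \<bar>x\<bar> \<Longrightarrow> q x = k\<^sup>2"
    and left: "p (- R) = k * f (- R)" and right: "p R = - k * f R"
  obtains F P where "schr_solution q UNIV F P"
    "\<And>x. x \<le> - R \<Longrightarrow> F x = f (- R) * exp (k * (x + R))" "\<And>x. x \<le> - R \<Longrightarrow> P x = k * F x"
    "\<And>x. R \<le> x \<Longrightarrow> F x = f R * exp (- k * (x - R))" "\<And>x. R \<le> x \<Longrightarrow> P x = - k * F x"
proof
  define F where "F x = (if x \<le> - R then f (- R) * exp (k * (x - - R)) else if x < R then f x
    else f R * exp (- k * (x - R)))" for x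
  define P where "P x = (if x \<le> - R then k * F x else if x < R then p x else - k * F x)" for x
  show F_left: "F x = f (- R) * exp (k * (x + R))" "P x = k * F x" if "x \<le> - R" for x
    using that by (simp_all add: F_def P_def)
  show F_right: "F x = f R * exp (- k * (x - R))" "P x = - k * F x" if "R \<le> x" for x
    using that R by (simp_all add: F_def P_def)
  have F_mid: "F x = f x" "P x = p x" if "x \<in> {- R..R}" for x
    using that F_left[of x] F_right[of x] left right
    by (cases "x = - R"; cases "x = R"; simp add: F_def P_def)+
  have "schr_solution q {..- R} F P"
  proof (rule schr_solution_cong[THEN iffD1])
    show "schr_solution q {..- R} (\<lambda>x. f (- R) * exp (k * (x - - R)))
      (\<lambda>x. k * (f (- R) * exp (k * (x - - R))))"
      by (rule schr_solution_exp) (use q R in auto)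
  qed (auto simp: F_left)
  moreover have "schr_solution q {- R..R} F P"
    using schr_solution_cong[of "{- R..R}" q q F f P p] F_mid sol by simp
  moreover have "schr_solution q {R..} F P"
  proof (rule schr_solution_cong[THEN iffD1])
    show "schr_solution q {R..} (\<lambda>x. f R * exp (- k * (x - R))) (\<lambda>x. - k * (f R * exp (- k * (x - R))))"
      by (rule schr_solution_exp) (use q R in auto)
  qed (auto simp: F_right)
  moreover have "{..R} \<inter> {..- R} = {..- R}" "{..R} \<inter> {- R..} = {- R..R}" using R by auto
  ultimately show "schr_solution q UNIV F P"
    using schr_solution_join[of q "{..R}" "- R" F P] schr_solution_join[of q UNIV R F P] by simp
qed

section \<open>Jost solutions\<close>

text \<open>The data at \<open>-R\<close> are those of \<open>e\<^bsup>k (x + R)\<^esup>\<close>, the solution at energy \<open>-k\<^sup>2\<close> to the left of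
  the support that decays at \<open>-\<infinity>\<close>; \<open>jost_mismatch\<close> vanishes if the solution decays at \<open>+\<infinity>\<close> as well.\<close>

definition jost_pair :: "real \<Rightarrow> (real \<Rightarrow> real) \<Rightarrow> real \<Rightarrow> (real \<Rightarrow> real) \<times> (real \<Rightarrow> real)" where
  "jost_pair R W k = (SOME y. schr_solution (\<lambda>x. W x + k\<^sup>2) {- R..R} (fst y) (snd y) \<and>
     fst y (- R) = 1 \<and> snd y (- R) = k)"

definition jost :: "real \<Rightarrow> (real \<Rightarrow> real) \<Rightarrow> real \<Rightarrow> real \<Rightarrow> real" where
  "jost R W k = fst (jost_pair R W k)"

definition jost_deriv :: "real \<Rightarrow> (real \<Rightarrow> real) \<Rightarrow> real \<Rightarrow> real \<Rightarrow> real" where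
  "jost_deriv R W k = snd (jost_pair R W k)"

lemma jost_solution:
  assumes W: "bounded_borel W" and R: "0 \<le> R"
  shows "schr_solution (\<lambda>x. W x + k\<^sup>2) {- R..R} (jost R W k) (jost_deriv R W k)"
    "jost R W k (- R) = 1" "jost_deriv R W k (- R) = k"
proof -
  have "bounded_borel (\<lambda>x. W x + k\<^sup>2)" by (intro bounded_borel_intros W)
  then obtain f p where "schr_solution (\<lambda>x. W x + k\<^sup>2) {- R..R} f p" "f (- R) = 1" "p (- R) = k"
    by (rule schr_solution_exists[of _ "- R" R 1 k]) (use R in auto)
  then have "\<exists>y. schr_solution (\<lambda>x. W x + k\<^sup>2) {- R..R} (fst y) (snd y) \<and>
      fst y (- R) = 1 \<and> snd y (- R) = k"
    by (intro exI[of _ "(f, p)"]) simp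
  from someI_ex[OF this, folded jost_pair_def]
  show "schr_solution (\<lambda>x. W x + k\<^sup>2) {- R..R} (jost R W k) (jost_deriv R W k)"
    "jost R W k (- R) = 1" "jost_deriv R W k (- R) = k"
    by (simp_all add: jost_def jost_deriv_def)
qed

definition jost_mismatch :: "real \<Rightarrow> (real \<Rightarrow> real) \<Rightarrow> real \<Rightarrow> real" where
  "jost_mismatch R W k = jost_deriv R W k R + k * jost R W k R"

lemma continuous_on_jost_mismatch:
  assumes W: "bounded_borel W" and R: "0 \<le> R"
  shows "continuous_on S (jost_mismatch R W)"
proof -
  have "isCont (jost_mismatch R W) k" for k
  proof -
    have diff: "\<bar>(W x + h\<^sup>2) - (W x + k\<^sup>2)\<bar> \<le> \<bar>h\<^sup>2 - k\<^sup>2\<bar>" for h x by simp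
    have "((\<lambda>h. \<bar>h\<^sup>2 - k\<^sup>2\<bar>) \<longlongrightarrow> \<bar>k\<^sup>2 - k\<^sup>2\<bar>) (at k)" by (intro tendsto_intros)
    then have zero: "((\<lambda>h. \<bar>h\<^sup>2 - k\<^sup>2\<bar>) \<longlongrightarrow> 0) (at k)" by simp
    have q: "bounded_borel (\<lambda>x. W x + k\<^sup>2)" by (intro bounded_borel_intros W)
    have init: "((\<lambda>h. jost R W h (- R)) \<longlongrightarrow> jost R W k (- R)) (at k)"
      "((\<lambda>h. jost_deriv R W h (- R)) \<longlongrightarrow> jost_deriv R W k (- R)) (at k)"
      by (simp_all add: jost_solution(2,3)[OF W R])
    note lim = schr_solution_uniform_limit[OF jost_solution(1)[OF W R] jost_solution(1)[OF W R]
      q diff zero init]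
    have "((\<lambda>h. jost R W h R) \<longlongrightarrow> jost R W k R) (at k)"
      "((\<lambda>h. jost_deriv R W h R) \<longlongrightarrow> jost_deriv R W k R) (at k)"
      using lim[THEN tendsto_uniform_limitI, of R] R by simp_all
    then show ?thesis unfolding isCont_def jost_mismatch_def by (intro tendsto_intros)
  qed
  then show ?thesis by (simp add: continuous_at_imp_continuous_on)
qed

lemma jost_mismatch_zero_imp_schr_eigenvalue:
  assumes W: "bounded_borel W" and supp: "\<And>x. R \<le> \<bar>x\<bar> \<Longrightarrow> W x = 0" and R: "0 < R" and k: "0 < k"
    and zero: "jost_mismatch R W k = 0"
  shows "schr_eigenvalue W (- k\<^sup>2)"
proof -
  let ?f = "jost R W k"
  note jost = jost_solution[OF W less_imp_le[OF R], of k]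
  obtain F P where sol: "schr_solution (\<lambda>x. W x + k\<^sup>2) UNIV F P"
    and left: "\<And>x. x \<le> - R \<Longrightarrow> F x = ?f (- R) * exp (k * (x + R))" "\<And>x. x \<le> - R \<Longrightarrow> P x = k * F x"
    and right: "\<And>x. R \<le> x \<Longrightarrow> F x = ?f R * exp (- k * (x - R))" "\<And>x. R \<le> x \<Longrightarrow> P x = - k * F x"
    by (rule schr_solution_glue_exp[OF jost(1) R, of k])
      (use supp jost(2,3) zero in \<open>auto simp: jost_mismatch_def\<close>)
  define C where "C = max 1 \<bar>?f R\<bar> * exp (k * R)"
  have F_tails: "\<bar>F x\<bar> \<le> C * exp (- k * \<bar>x\<bar>)" if x: "R \<le> \<bar>x\<bar>" for x
  proof -
    have "\<bar>F x\<bar> \<le> max 1 \<bar>?f R\<bar> * exp (k * R - k * \<bar>x\<bar>)"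
    proof (cases "x \<le> - R")
      case True
      then have "\<bar>x\<bar> = - x" using R by simp
      with True show ?thesis by (simp add: left(1) jost(2) algebra_simps)
    next
      case False
      then have "R \<le> x" "\<bar>x\<bar> = x" using x R by auto
      then show ?thesis by (simp add: right(1) abs_mult algebra_simps)
    qed
    then show ?thesis by (simp add: C_def mult_exp_exp mult.assoc)
  qed
  moreover have "\<bar>P x\<bar> \<le> (k * C) * exp (- k * \<bar>x\<bar>)" if x: "R \<le> \<bar>x\<bar>" for x
  proof -
    have "\<bar>P x\<bar> = k * \<bar>F x\<bar>"
      using left(2)[of x] right(2)[of x] x k by (cases "x \<le> - R") (auto simp: abs_mult)
    then show ?thesis using mult_left_mono[OF F_tails[OF x], of k] k by (simp add: mult.assoc)
  qed
  moreover have "F (- R) \<noteq> 0" using left(1)[of "- R"] jost(2) by simp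
  ultimately show ?thesis by (rule exp_tails_imp_schr_eigenvalue[OF sol W k])
qed

section \<open>Half-bound states\<close>

lemma Linf_compact_representative:
  assumes "Linf_compact U"
  obtains U0 R where "bounded_borel U0" "\<And>x. R < \<bar>x\<bar> \<Longrightarrow> U0 x = 0" "AE x in lborel. U x = U0 x"
proof -
  from assms obtain M R where U: "U \<in> borel_measurable borel" "AE x in lborel. \<bar>U x\<bar> \<le> M"
    "AE x in lborel. R < \<bar>x\<bar> \<longrightarrow> U x = 0" by (auto simp: Linf_compact_def)
  let ?U0 = "\<lambda>x. if \<bar>x\<bar> \<le> R \<and> \<bar>U x\<bar> \<le> M then U x else 0"
  show ?thesis
  proof (rule that[of ?U0 R])
    have "?U0 \<in> borel_measurable borel" using U(1) by measurable
    then show "bounded_borel ?U0" by (rule bounded_borelI[of _ "\<bar>M\<bar>"]) auto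
    show "AE x in lborel. U x = ?U0 x" using U(2,3) by eventually_elim auto
  qed auto
qed

lemma half_bound_state_imp_schr_solution:
  assumes hbs: "half_bound_state U h" and eq: "AE x in lborel. U x = U0 x"
  shows "schr_solution U0 UNIV h (deriv h)"
proof -
  from hbs obtain h' g where deriv: "\<And>x. (h has_real_derivative h' x) (at x)"
    and g: "primitive_on UNIV h' g"
    and ode: "AE x in lborel. - g x + U x * h x = 0"
    unfolding half_bound_state_def second_deriv_iff_primitive_on by blast
  from ode eq have ae: "AE x in lborel. x \<in> S \<longrightarrow> U0 x * h x = g x" for S by eventually_elim simp
  have "primitive_on UNIV h' (\<lambda>x. U0 x * h x)"
  proof (rule primitive_onI)
    fix x y :: real assume "x \<le> y" "{x..y} \<subseteq> UNIV"
    from primitive_onD[OF g this] show "((\<lambda>x. U0 x * h x) has_integral h' y - h' x) {x..y}"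
      by (rule has_integral_AE[OF ae, THEN iffD2])
  qed
  moreover have "primitive_on UNIV h h'"
    using deriv
    by (intro has_vector_derivative_imp_primitive_on)
      (simp add: has_real_derivative_iff_has_vector_derivative)
  moreover have "deriv h = h'" using deriv by (intro ext DERIV_imp_deriv)
  ultimately show ?thesis by (simp add: schr_solution_def)
qed

lemma schr_solution_zero_potential_affine:
  assumes sol: "schr_solution q S f p" and S: "is_interval S" and q: "\<And>x. x \<in> S \<Longrightarrow> q x = 0"
    and x: "x \<in> S" and y: "y \<in> S"
  shows "f y = f x + p x * (y - x)"
proof -
  have p: "p t = p x" if "t \<in> S" for t
    by (rule primitive_on_zero_imp_eq[OF schr_solutionD(2)[OF sol] S _ x that]) (simp add: q)
  have linear: "primitive_on S (\<lambda>y. p x * y) (\<lambda>y. p x)"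
    by (rule has_vector_derivative_imp_primitive_on)
      (simp add: DERIV_cmult_Id flip: has_real_derivative_iff_has_vector_derivative)
  have "f y - p x * y = f x - p x * x"
  proof (rule primitive_on_zero_imp_eq[OF primitive_on_diff[OF schr_solutionD(1)[OF sol] linear]
        S _ x y])
    show "p t - p x = 0" if "t \<in> S" for t using p[OF that] by simp
  qed
  then show ?thesis by (simp add: algebra_simps)
qed

lemma bounded_schr_solution_zero_potential:
  assumes sol: "schr_solution q S f p" and S: "is_interval S" "\<not> bounded S"
    and q: "\<And>x. x \<in> S \<Longrightarrow> q x = 0" and f: "bounded (f ` S)" and x: "x \<in> S"
  shows "p x = 0" and "y \<in> S \<Longrightarrow> f y = f x"
proof -
  have affine: "f y = f x + p x * (y - x)" if "y \<in> S" for y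
    using q by (intro schr_solution_zero_potential_affine[OF sol S(1) _ x that])
  obtain B where B: "\<forall>y\<in>S. \<bar>f y\<bar> \<le> B" using f by (auto simp: bounded_iff)
  show "p x = 0"
  proof (rule ccontr)
    assume px: "p x \<noteq> 0"
    have "norm y \<le> 2 * B / \<bar>p x\<bar> + \<bar>x\<bar>" if "y \<in> S" for y
    proof -
      have "p x * (y - x) = f y - f x" using affine[OF that] by simp
      moreover have "\<bar>f y\<bar> \<le> B" "\<bar>f x\<bar> \<le> B" using B that x by simp_all
      ultimately have "\<bar>p x * (y - x)\<bar> \<le> 2 * B" by linarith
      then have "\<bar>y - x\<bar> \<le> 2 * B / \<bar>p x\<bar>" using px by (simp add: abs_mult pos_le_divide_eq mult.commute)
      then show ?thesis unfolding real_norm_def by linarith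
    qed
    then have "bounded S" by (rule boundedI)
    with S(2) show False ..
  qed
  with affine[of y] show "f y = f x" if "y \<in> S" using that by simp
qed

lemma half_bound_state_boundary_values:
  assumes sol: "schr_solution U UNIV u u'" and supp: "\<And>x. R \<le> \<bar>x\<bar> \<Longrightarrow> U x = 0" and R: "0 \<le> R"
    and bdd: "bounded (range u)" and at_bot: "(u \<longlongrightarrow> \<theta>) at_bot" and at_top: "(u \<longlongrightarrow> \<psi>) at_top"
  shows "u (- R) = \<theta>" "u' (- R) = 0" "u R = \<psi>" "u' R = 0"
proof -
  have bdd': "bounded (u ` S)" for S using bdd by (rule bounded_subset) auto
  have U: "\<And>x. x \<in> {..- R} \<Longrightarrow> U x = 0" "\<And>x. x \<in> {R..} \<Longrightarrow> U x = 0"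
    using supp R by auto
  have "\<exists>x\<in>{..- R}. B < \<bar>x\<bar>" for B using R by (intro bexI[of _ "- (R + \<bar>B\<bar> + 1)"]) auto
  moreover have "\<exists>x\<in>{R..}. B < \<bar>x\<bar>" for B using R by (intro bexI[of _ "R + \<bar>B\<bar> + 1"]) auto
  ultimately have unbounded: "\<not> bounded {..- R}" "\<not> bounded {R..}"
    unfolding bounded_iff real_norm_def by (meson not_le)+
  note left = bounded_schr_solution_zero_potential[OF schr_solution_subset[OF sol subset_UNIV]
      is_interval_ic unbounded(1) U(1) bdd', of "- R"]
  note right = bounded_schr_solution_zero_potential[OF schr_solution_subset[OF sol subset_UNIV]
      is_interval_ci unbounded(2) U(2) bdd', of R]
  show "u' (- R) = 0" "u' R = 0" using left(1) right(1) by simp_all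
  have "\<forall>\<^sub>F x in at_bot. u x = u (- R)" using eventually_le_at_bot[of "- R"]
    by eventually_elim (rule left(2), simp_all)
  then have "(u \<longlongrightarrow> u (- R)) at_bot" by (rule tendsto_eventually)
  then show "u (- R) = \<theta>" using tendsto_unique[OF trivial_limit_at_bot_linorder _ at_bot] by blast
  have "\<forall>\<^sub>F x in at_top. u x = u R" using eventually_ge_at_top[of R]
    by eventually_elim (rule right(2), simp_all)
  then have "(u \<longlongrightarrow> u R) at_top" by (rule tendsto_eventually)
  then show "u R = \<psi>" using tendsto_unique[OF trivial_limit_at_top_linorder _ at_top] by blast
qed

section \<open>Dipole limits\<close>

lemma dipole_integral_error:
  fixes V h :: "real \<Rightarrow> real"
  assumes V: "integrable lborel V" "integrable lborel (\<lambda>x. x * V x)"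
    and mean: "(LINT x|lborel. V x) = 0"
    and a: "0 < a" and h: "h \<in> borel_measurable borel"
    and approx: "\<And>x. V (a * x) \<noteq> 0 \<Longrightarrow> \<bar>h x - h0 - c * x\<bar> \<le> e * \<bar>x\<bar>"
  shows "\<bar>a\<^sup>2 * (LINT x|lborel. V (a * x) * h x) - c * (LINT x|lborel. x * V x)\<bar>
    \<le> e * (LINT x|lborel. \<bar>x * V x\<bar>)"
proof -
  define r where "r t = a * V t * (h (t / a) - h0 - c * (t / a))" for t
  have r_le: "\<bar>r t\<bar> \<le> e * \<bar>t * V t\<bar>" for t
  proof (cases "V t = 0")
    case False
    then have "a * \<bar>V t\<bar> * \<bar>h (t / a) - h0 - c * (t / a)\<bar> \<le> a * \<bar>V t\<bar> * (e * \<bar>t / a\<bar>)"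
      using approx[of "t / a"] a by (intro mult_left_mono) auto
    then show ?thesis using a by (simp add: r_def abs_mult mult_ac)
  qed (simp add: r_def)
  have bound: "integrable lborel (\<lambda>t. e * \<bar>t * V t\<bar>)" using V(2)
    by (intro integrable_mult_right integrable_abs)
  have "V \<in> borel_measurable lborel" using V(1) by (rule borel_measurable_integrable)
  then have r: "integrable lborel r"
    using h r_le unfolding r_def
    by (intro Bochner_Integration.integrable_bound[OF bound])
      (auto intro!: AE_I2 order_trans[OF _ abs_ge_self])
  have "a\<^sup>2 * (LINT x|lborel. V (a * x) * h x)
    = a * (\<bar>a\<bar> *\<^sub>R (LINT x|lborel. V (0 + a * x) * h ((0 + a * x) / a)))"
    using a by (simp add: power2_eq_square)
  also have "\<dots> = a * (LINT t|lborel. V t * h (t / a))"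
    by (subst lborel_integral_real_affine[of a "\<lambda>t. V t * h (t / a)" 0]) (use a in auto)
  also have "\<dots> = (LINT t|lborel. r t + (a * h0 * V t + c * (t * V t)))"
    using a by (simp add: r_def algebra_simps flip: integral_mult_right_zero)
  also have "\<dots> = (LINT t|lborel. r t) + c * (LINT t|lborel. t * V t)"
    using r V mean by simp
  finally have "\<bar>a\<^sup>2 * (LINT x|lborel. V (a * x) * h x) - c * (LINT x|lborel. x * V x)\<bar>
    = \<bar>LINT t|lborel. r t\<bar>"
    by simp
  also have "\<dots> \<le> (LINT t|lborel. e * \<bar>t * V t\<bar>)"
    using Bochner_Integration.integral_norm_bound_integral[OF r bound] r_le by simp
  finally show ?thesis by simp
qed

lemma integrable_bounded_borel_compact_support:
  assumes V: "bounded_borel V" and supp: "\<And>x. x \<notin> {a..b} \<Longrightarrow> V x = 0" and f: "continuous_on {a..b} f"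
  shows "integrable lborel (\<lambda>x. f x * V x)"
proof -
  have "set_integrable lborel {a..b} (\<lambda>x. V x * f x)"
    by (intro set_integrable_bounded_borel_mult V borel_integrable_atLeastAtMost' f)
  moreover have "(\<lambda>x. indicator {a..b} x *\<^sub>R (V x * f x)) = (\<lambda>x. f x * V x)"
  proof
    show "indicator {a..b} x *\<^sub>R (V x * f x) = f x * V x" for x
      using supp[of x] by (cases "x \<in> {a..b}") simp_all
  qed
  ultimately show ?thesis unfolding set_integrable_def by simp
qed

lemma dipole_integral_error_Icc:
  assumes V: "bounded_borel V" and supp: "\<And>x. R \<le> \<bar>x\<bar> \<Longrightarrow> V x = 0" and mean: "(LINT x|lborel. V x) = 0"
    and a: "1 \<le> a" and h: "continuous_on {- R..R} h"
    and approx: "\<And>x. a * \<bar>x\<bar> < R \<Longrightarrow> \<bar>h x - h0 - c * x\<bar> \<le> e * \<bar>x\<bar>"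
  shows "\<bar>a\<^sup>2 * integral {- R..R} (\<lambda>x. V (a * x) * h x) - c * (LINT x|lborel. x * V x)\<bar>
    \<le> e * (LINT x|lborel. \<bar>x * V x\<bar>)"
proof -
  have supp': "V x = 0" if "x \<notin> {- R..R}" for x using supp[of x] that by auto
  have int: "integrable lborel V" "integrable lborel (\<lambda>x. x * V x)"
    using integrable_bounded_borel_compact_support[OF V supp', where f = "\<lambda>x. 1"]
      integrable_bounded_borel_compact_support[OF V supp', where f = "\<lambda>x. x"] by simp_all
  define H where "H x = indicator {- R..R} x * h x" for x
  have H: "H \<in> borel_measurable borel"
    using borel_measurable_continuous_on_indicator[OF _ h] by (simp add: H_def[abs_def])
  have "set_integrable lborel {- R..R} (\<lambda>x. V (a * x) * h x)"
    by (intro set_integrable_bounded_borel_mult bounded_borel_intros V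
      borel_integrable_atLeastAtMost' h)
  from set_borel_integral_eq_integral(2)[OF this, symmetric]
  have lebesgue: "integral {- R..R} (\<lambda>x. V (a * x) * h x) = (LINT x|lborel. V (a * x) * H x)"
    by (simp add: set_lebesgue_integral_def H_def mult_ac)
  have "\<bar>H x - h0 - c * x\<bar> \<le> e * \<bar>x\<bar>" if "V (a * x) \<noteq> 0" for x
  proof -
    have ax: "a * \<bar>x\<bar> < R" using supp[of "a * x"] that a by (force simp: abs_mult)
    have "1 * \<bar>x\<bar> \<le> a * \<bar>x\<bar>" using a by (rule mult_right_mono) simp
    with ax have "x \<in> {- R..R}" by auto
    then show ?thesis using approx[OF ax] by (simp add: H_def)
  qed
  from dipole_integral_error[OF int mean _ H this] a show ?thesis unfolding lebesgue by simp
qed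

lemma dipole_limit:
  fixes h :: "'b \<Rightarrow> real \<Rightarrow> real"
  assumes V: "bounded_borel V" and supp: "\<And>x. R \<le> \<bar>x\<bar> \<Longrightarrow> V x = 0" and mean: "(LINT x|lborel. V x) = 0"
    and a: "filterlim a at_top F" and h: "\<And>n. continuous_on {- R..R} (h n)"
    and approx: "\<And>e. 0 < e \<Longrightarrow>
      \<exists>d>0. \<forall>\<^sub>F n in F. \<forall>x. \<bar>x\<bar> \<le> d \<longrightarrow> \<bar>h n x - h n 0 - c * x\<bar> \<le> e * \<bar>x\<bar>"
  shows "((\<lambda>n. (a n)\<^sup>2 * integral {- R..R} (\<lambda>x. V (a n * x) * h n x))
    \<longlongrightarrow> c * (LINT x|lborel. x * V x)) F"
proof (rule tendstoI)
  let ?I = "\<lambda>n. (a n)\<^sup>2 * integral {- R..R} (\<lambda>x. V (a n * x) * h n x)"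
  define K where "K = (LINT x|lborel. \<bar>x * V x\<bar>)"
  have K: "0 \<le> K" unfolding K_def by (rule integral_nonneg_AE) simp
  fix \<epsilon> :: real assume \<epsilon>: "0 < \<epsilon>"
  define e where "e = \<epsilon> / (K + 1)"
  have e: "0 < e" "e * K < \<epsilon>" using \<epsilon> K by (auto simp: e_def field_simps)
  from approx[OF e(1)] obtain d where d: "0 < d"
    and near: "\<forall>\<^sub>F n in F. \<forall>x. \<bar>x\<bar> \<le> d \<longrightarrow> \<bar>h n x - h n 0 - c * x\<bar> \<le> e * \<bar>x\<bar>" by blast
  have "\<forall>\<^sub>F n in F. max 1 (R / d) \<le> a n" using a unfolding filterlim_at_top by blast
  with near show "\<forall>\<^sub>F n in F. dist (?I n) (c * (LINT x|lborel. x * V x)) < \<epsilon>"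
  proof eventually_elim
    case (elim n)
    then have a: "1 \<le> a n" "R / d \<le> a n" by auto
    have "\<bar>h n x - h n 0 - c * x\<bar> \<le> e * \<bar>x\<bar>" if x: "a n * \<bar>x\<bar> < R" for x
    proof -
      have "R / d * d \<le> a n * \<bar>x\<bar>" if "d \<le> \<bar>x\<bar>"
        using a that d by (intro mult_mono) auto
      then have "\<bar>x\<bar> \<le> d" using x d by fastforce
      with elim show ?thesis by blast
    qed
    from dipole_integral_error_Icc[OF V supp mean a(1) h this]
    have "\<bar>?I n - c * (LINT x|lborel. x * V x)\<bar> \<le> e * K" by (simp add: K_def)
    with e(2) show ?case by (simp add: dist_norm)
  qed
qed

lemma uniform_limit_deriv_imp_uniform_differentiable:
  fixes h :: "'b \<Rightarrow> 'a::real_normed_field \<Rightarrow> 'a"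
  assumes deriv: "\<And>n x. x \<in> ball x0 r \<Longrightarrow> (h n has_field_derivative h' n x) (at x)"
    and lim: "uniform_limit (ball x0 r) h' g F" and g: "isCont g x0" and r: "0 < r" and e: "0 < e"
  shows "\<exists>d>0. \<forall>\<^sub>F n in F. \<forall>x\<in>cball x0 d. norm (h n x - h n x0 - g x0 * (x - x0)) \<le> e * norm (x - x0)"
proof -
  have "0 < e / 2" using e by simp
  then obtain d0 where d0: "0 < d0" "\<forall>x. dist x x0 < d0 \<longrightarrow> dist (g x) (g x0) < e / 2"
    using g unfolding continuous_at_eps_delta by blast
  define d where "d = min d0 r / 2"
  have d: "0 < d" "d < d0" "d < r" using d0 r by (auto simp: d_def min_def)
  from uniform_limitD[OF lim \<open>0 < e / 2\<close>]
  have "\<forall>\<^sub>F n in F. \<forall>x\<in>cball x0 d. norm (h n x - h n x0 - g x0 * (x - x0)) \<le> e * norm (x - x0)"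
  proof (eventually_elim, intro ballI)
    fix n x assume close: "\<forall>x\<in>ball x0 r. dist (h' n x) (g x) < e / 2" and x: "x \<in> cball x0 d"
    have "norm ((h n x - g x0 * x) - (h n x0 - g x0 * x0)) \<le> e * norm (x - x0)"
    proof (rule field_differentiable_bound[of "cball x0 d"])
      fix z assume z: "z \<in> cball x0 d"
      then have zr: "z \<in> ball x0 r" using d by auto
      show "((\<lambda>x. h n x - g x0 * x) has_field_derivative h' n z - g x0) (at z within cball x0 d)"
        by (rule DERIV_diff[OF has_field_derivative_at_within[OF deriv[OF zr]] DERIV_cmult_Id])
      have "dist z x0 < d0" using z d by (simp add: dist_commute)
      then have "norm (g z - g x0) < e / 2" using d0(2) by (simp add: dist_norm)
      then show "norm (h' n z - g x0) \<le> e"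
        using close[rule_format, OF zr] norm_triangle_ineq[of "h' n z - g z" "g z - g x0"]
        by (simp add: dist_norm)
    qed (use x d in auto)
    then show "norm (h n x - h n x0 - g x0 * (x - x0)) \<le> e * norm (x - x0)" by (simp add: algebra_simps)
  qed
  with d(1) show ?thesis by blast
qed

lemma tendsto_nearest_point_selection:
  fixes c :: "'a::heine_borel" and S :: "'b \<Rightarrow> 'a set"
  assumes closed: "\<And>n. closed (S n)" and near: "\<And>e. 0 < e \<Longrightarrow> \<forall>\<^sub>F n in F. \<exists>x\<in>S n. dist c x < e"
  obtains s where "(s \<longlongrightarrow> c) F" "\<forall>\<^sub>F n in F. s n \<in> S n"
proof -
  have nearest: "\<exists>x. S n \<noteq> {} \<longrightarrow> x \<in> S n \<and> (\<forall>y\<in>S n. dist c x \<le> dist c y)" for n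
  proof (cases "S n = {}")
    case False
    obtain x where "x \<in> S n" "\<And>y. y \<in> S n \<Longrightarrow> dist c x \<le> dist c y"
      using closed[of n] False by (rule distance_attains_inf[where a = c]) blast
    then show ?thesis by blast
  qed simp
  from choice[OF allI[OF nearest]]
  obtain s where "\<forall>n. S n \<noteq> {} \<longrightarrow> s n \<in> S n \<and> (\<forall>y\<in>S n. dist c (s n) \<le> dist c y)" ..
  then have s: "s n \<in> S n" "dist c (s n) \<le> dist c x" if "x \<in> S n" for n x
    using that by blast+
  show ?thesis
  proof (rule that)
    show "(s \<longlongrightarrow> c) F"
    proof (rule tendstoI)
      fix e :: real assume "0 < e"
      from near[OF this] show "\<forall>\<^sub>F n in F. dist (s n) c < e"
      proof eventually_elim
        case (elim n)
        then obtain x where "x \<in> S n" "dist c x < e" by blast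
        then show ?case using s(2)[of x n] by (simp add: dist_commute)
      qed
    qed
    show "\<forall>\<^sub>F n in F. s n \<in> S n"
      using near[OF zero_less_one] by eventually_elim (blast intro: s(1))
  qed
qed

lemma zeros_tendsto_sign_change:
  fixes G :: "'b \<Rightarrow> real \<Rightarrow> real"
  assumes cont: "\<And>n. continuous_on UNIV (G n)" and lim: "\<And>s. ((\<lambda>n. G n s) \<longlongrightarrow> g s) F"
    and neg: "\<And>s. s < c \<Longrightarrow> g s < 0" and pos: "\<And>s. c < s \<Longrightarrow> 0 < g s"
  obtains s where "(s \<longlongrightarrow> c) F" "\<forall>\<^sub>F n in F. G n (s n) = 0"
proof -
  have closed: "closed {s. G n s = 0}" for n
    by (rule closed_Collect_eq[OF cont continuous_on_const])
  have near: "\<forall>\<^sub>F n in F. \<exists>s\<in>{s. G n s = 0}. dist c s < e" if e: "0 < e" for e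
  proof -
    have "\<forall>\<^sub>F n in F. G n (c - e / 2) < 0" by (rule order_tendstoD(2)[OF lim neg]) (use e in simp)
    moreover have "\<forall>\<^sub>F n in F. 0 < G n (c + e / 2)"
      by (rule order_tendstoD(1)[OF lim pos]) (use e in simp)
    ultimately show ?thesis
    proof eventually_elim
      case (elim n)
      then obtain s where "c - e / 2 \<le> s" "s \<le> c + e / 2" "G n s = 0"
        using IVT'[of "G n" "c - e / 2" 0 "c + e / 2"] continuous_on_subset[OF cont[of n] subset_UNIV]
          e by auto
      then show ?case using e by (intro bexI[of _ s]) (auto simp: dist_real_def)
    qed
  qed
  obtain s where "(s \<longlongrightarrow> c) F" "\<forall>\<^sub>F n in F. s n \<in> {s. G n s = 0}"
    using closed near by (rule tendsto_nearest_point_selection)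
  then show ?thesis by (intro that) simp_all
qed

section \<open>Resonant potentials with a short-range dipole perturbation\<close>

locale half_bound =
  fixes U u u' :: "real \<Rightarrow> real" and R \<theta> :: real
  assumes U: "bounded_borel U" and U_supp: "R \<le> \<bar>x\<bar> \<Longrightarrow> U x = 0" and R: "0 < R"
    and sol_u: "schr_solution U {- R..R} u u'"
    and u_left: "u (- R) = 1" "u' (- R) = 0" and u_right: "u R = \<theta>" "u' R = 0"
begin

text \<open>If \<open>\<theta> = 0\<close>, the conserved Wronskian with the solution starting from data \<open>(0, 1)\<close>
  would be both 1 and 0.\<close>

lemma theta_nonzero: "\<theta> \<noteq> 0"
proof
  assume "\<theta> = 0"
  obtain g s where g: "schr_solution U {- R..R} g s" "g (- R) = 0" "s (- R) = 1"
    using schr_solution_exists[OF U, of "- R" R 0 1] R by auto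
  have "((\<lambda>x. (U x - U x) * (u x * g x))
    has_integral (u R * s R - u' R * g R) - (u (- R) * s (- R) - u' (- R) * g (- R))) {- R..R}"
    using R by (intro primitive_onD[OF schr_solution_wronskian[OF sol_u g(1) U U]]) auto
  then have "((\<lambda>x. 0::real) has_integral -1) {- R..R}" using \<open>\<theta> = 0\<close> g u_left u_right by simp
  from has_integral_unique[OF this has_integral_0] show False by simp
qed

lemma jost_mismatch_eq:
  assumes W: "bounded_borel W"
  shows "\<theta> * jost_mismatch R W k = k + k * \<theta> * jost R W k R
    + integral {- R..R} (\<lambda>x. (W x + k\<^sup>2 - U x) * (u x * jost R W k x))"
proof -
  note jost = jost_solution[OF W less_imp_le[OF R], of k]
  have "bounded_borel (\<lambda>x. W x + k\<^sup>2)" by (intro bounded_borel_intros W)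
  from primitive_onD[OF schr_solution_wronskian[OF sol_u jost(1) U this], of "- R" R]
  have "((\<lambda>x. (W x + k\<^sup>2 - U x) * (u x * jost R W k x)) has_integral \<theta> * jost_deriv R W k R - k)
    {- R..R}"
    using R u_left u_right jost(2,3) by simp
  from integral_unique[OF this] show ?thesis by (simp add: jost_mismatch_def algebra_simps)
qed

end

locale half_bound_dipole = half_bound +
  fixes V :: "real \<Rightarrow> real"
  assumes V: "bounded_borel V" and V_supp: "R \<le> \<bar>x\<bar> \<Longrightarrow> V x = 0" and V_mean: "(LINT x|lborel. V x) = 0"
begin

definition potential :: "real \<Rightarrow> real \<Rightarrow> real \<Rightarrow> real" where
  "potential l a x = U x + l * a * V (a * x)"

definition threshold_rate :: real where
  "threshold_rate = - (2 * u 0 * u' 0 / (\<theta>\<^sup>2 + 1) * (LINT x|lborel. x * V x))"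

lemma threshold_rate_times_denominator:
  "threshold_rate * (\<theta>\<^sup>2 + 1) = - (2 * u 0 * u' 0 * (LINT x|lborel. x * V x))"
proof -
  have "0 < \<theta>\<^sup>2 + 1" by (simp add: add_nonneg_pos)
  then show ?thesis by (simp add: threshold_rate_def)
qed

lemma bounded_borel_potential: "bounded_borel (potential l a)"
  unfolding potential_def by (intro bounded_borel_intros U V)

lemma potential_supp:
  assumes "1 \<le> a" "R \<le> \<bar>x\<bar>"
  shows "potential l a x = 0"
proof -
  have "1 * \<bar>x\<bar> \<le> a * \<bar>x\<bar>" using assms(1) by (rule mult_right_mono) simp
  then have "R \<le> \<bar>a * x\<bar>" using assms by (simp add: abs_mult)
  then show ?thesis using assms(2) by (simp add: potential_def U_supp V_supp)
qed

lemmas jost_potential = jost_solution[OF bounded_borel_potential less_imp_le[OF R]]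

lemma continuous_on_u_jost: "continuous_on {- R..R} (\<lambda>x. u x * jost R (potential l a) k x)"
  by (intro continuous_intros schr_solution_continuous_on(1)[OF sol_u]
      schr_solution_continuous_on(1)[OF jost_potential(1)])

lemma rescaled_jost_mismatch_eq:
  fixes s :: real
  assumes l: "l \<noteq> 0" and a: "a \<noteq> 0"
  defines "f \<equiv> jost R (potential l a) (s * (l / a))"
  shows "a / l * (\<theta> * jost_mismatch R (potential l a) (s * (l / a))) = s + s * \<theta> * f R
    + a\<^sup>2 * integral {- R..R} (\<lambda>x. V (a * x) * (u x * f x))
    + s\<^sup>2 * (l / a) * integral {- R..R} (\<lambda>x. u x * f x)"
proof -
  define k where "k = s * (l / a)"
  let ?I = "integral {- R..R} (\<lambda>x. V (a * x) * (u x * f x))"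
    and ?J = "integral {- R..R} (\<lambda>x. u x * f x)"
  have cont: "continuous_on {- R..R} (\<lambda>x. u x * f x)" unfolding f_def by (rule continuous_on_u_jost)
  then have "(\<lambda>x. V (a * x) * (u x * f x)) integrable_on {- R..R}"
    "(\<lambda>x. u x * f x) integrable_on {- R..R}"
    by (intro integrable_on_bounded_borel_mult integrable_continuous_real bounded_borel_intros V;
      assumption)+
  then have "integral {- R..R} (\<lambda>x. l * a * (V (a * x) * (u x * f x)) + k\<^sup>2 * (u x * f x))
    = l * a * ?I + k\<^sup>2 * ?J"
    by (subst Henstock_Kurzweil_Integration.integral_add) (auto intro: integrable_on_mult_right)
  moreover have "(potential l a x + k\<^sup>2 - U x) * (u x * f x)
    = l * a * (V (a * x) * (u x * f x)) + k\<^sup>2 * (u x * f x)" for x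
    by (simp add: potential_def algebra_simps)
  ultimately have "\<theta> * jost_mismatch R (potential l a) k = k + k * \<theta> * f R + (l * a * ?I + k\<^sup>2 * ?J)"
    using jost_mismatch_eq[OF bounded_borel_potential, of l a k] by (simp add: f_def k_def)
  then have "a / l * (\<theta> * jost_mismatch R (potential l a) k)
    = a / l * (k + k * \<theta> * f R + (l * a * ?I + k\<^sup>2 * ?J))" by simp
  also have "\<dots> = s + s * \<theta> * f R + a\<^sup>2 * ?I + s\<^sup>2 * (l / a) * ?J"
    using l a by (simp add: k_def field_simps power2_eq_square)
  finally show ?thesis by (simp add: k_def)
qed

end

locale half_bound_dipole_limit = half_bound_dipole +
  fixes F :: "'b filter" and l a :: "'b \<Rightarrow> real"
  assumes F: "F \<noteq> bot" and a: "filterlim a at_top F" and la: "((\<lambda>n. l n * a n) \<longlongrightarrow> 0) F"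
    and l: "\<forall>\<^sub>F n in F. 0 < l n"
begin

abbreviation W :: "'b \<Rightarrow> real \<Rightarrow> real" where
  "W n \<equiv> potential (l n) (a n)"

lemma a_pos: "\<forall>\<^sub>F n in F. 0 < a n"
  using a filterlim_at_top_dense by blast

lemma jost_uniform_limit:
  assumes k: "(k \<longlongrightarrow> 0) F"
  shows "uniform_limit {- R..R} (\<lambda>n. jost R (W n) (k n)) u F"
    "uniform_limit {- R..R} (\<lambda>n. jost_deriv R (W n) (k n)) u' F"
proof -
  obtain M where M: "\<And>x. \<bar>V x\<bar> \<le> M" using V by (meson bounded_borelE)
  have close: "\<bar>(W n x + (k n)\<^sup>2) - U x\<bar> \<le> \<bar>l n * a n\<bar> * M + (k n)\<^sup>2" for n x
  proof -
    have "\<bar>l n * a n * V (a n * x) + (k n)\<^sup>2\<bar> \<le> \<bar>l n * a n\<bar> * \<bar>V (a n * x)\<bar> + (k n)\<^sup>2"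
      using abs_triangle_ineq[of "l n * a n * V (a n * x)" "(k n)\<^sup>2"] by (simp add: abs_mult)
    also have "\<dots> \<le> \<bar>l n * a n\<bar> * M + (k n)\<^sup>2" by (intro add_right_mono mult_left_mono M) simp
    finally show ?thesis by (simp add: potential_def)
  qed
  have "((\<lambda>n. \<bar>l n * a n\<bar> * M + (k n)\<^sup>2) \<longlongrightarrow> \<bar>0\<bar> * M + 0\<^sup>2) F" by (intro tendsto_intros la k)
  then have small: "((\<lambda>n. \<bar>l n * a n\<bar> * M + (k n)\<^sup>2) \<longlongrightarrow> 0) F" by simp
  have init: "((\<lambda>n. jost R (W n) (k n) (- R)) \<longlongrightarrow> u (- R)) F"
    "((\<lambda>n. jost_deriv R (W n) (k n) (- R)) \<longlongrightarrow> u' (- R)) F"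
    using k by (simp_all add: jost_potential(2,3) u_left)
  from schr_solution_uniform_limit[OF sol_u jost_potential(1) U close small init]
  show "uniform_limit {- R..R} (\<lambda>n. jost R (W n) (k n)) u F"
    "uniform_limit {- R..R} (\<lambda>n. jost_deriv R (W n) (k n)) u' F" .
qed

lemma dipole_integral_tendsto:
  assumes k: "(k \<longlongrightarrow> 0) F"
  shows "((\<lambda>n. (a n)\<^sup>2 * integral {- R..R} (\<lambda>x. V (a n * x) * (u x * jost R (W n) (k n) x)))
    \<longlongrightarrow> 2 * u 0 * u' 0 * (LINT x|lborel. x * V x)) F"
proof -
  let ?f = "\<lambda>n. jost R (W n) (k n)" and ?p = "\<lambda>n. jost_deriv R (W n) (k n)"
  let ?g = "\<lambda>x. u' x * u x + u x * u' x"
  have "uniform_limit {- R..R} (\<lambda>n x. u' x * ?f n x + u x * ?p n x) ?g F"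
    by (intro uniform_limit_intros jost_uniform_limit k schr_solution_bounded[OF sol_u])
  then have lim: "uniform_limit (ball 0 R) (\<lambda>n x. u' x * ?f n x + u x * ?p n x) ?g F"
    by (rule uniform_limit_on_subset) (auto simp: dist_real_def)
  have deriv: "((\<lambda>x. u x * ?f n x) has_real_derivative u' x * ?f n x + u x * ?p n x) (at x)"
    if "x \<in> ball 0 R" for n x
  proof -
    have "x \<in> {- R<..<R}" using that by (auto simp: dist_real_def)
    from DERIV_mult[OF sol_u[THEN schr_solution_has_real_derivative, OF this]
        jost_potential(1)[THEN schr_solution_has_real_derivative, OF this]]
    show ?thesis by (simp add: mult.commute)
  qed
  have "continuous_on {- R..R} ?g" by (intro continuous_intros schr_solution_continuous_on[OF sol_u])
  then have "isCont ?g 0" by (rule continuous_on_interior) (use R in simp)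
  note uniform_limit_deriv_imp_uniform_differentiable[OF deriv lim this R]
  then have approx: "\<exists>d>0. \<forall>\<^sub>F n in F. \<forall>x. \<bar>x\<bar> \<le> d \<longrightarrow>
      \<bar>u x * ?f n x - u 0 * ?f n 0 - ?g 0 * x\<bar> \<le> e * \<bar>x\<bar>" if "0 < e" for e
    using that by (simp add: Ball_def)
  from dipole_limit[OF V V_supp V_mean a continuous_on_u_jost this] show ?thesis by (simp add: mult_ac)
qed

lemma coupling_ratio_tendsto_zero: "((\<lambda>n. l n / a n) \<longlongrightarrow> 0) F"
proof -
  have "((\<lambda>n. inverse (a n)) \<longlongrightarrow> 0) F" by (rule tendsto_inverse_0_at_top[OF a])
  then have "((\<lambda>n. (l n * a n) * (inverse (a n) * inverse (a n))) \<longlongrightarrow> 0 * (0 * 0)) F"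
    by (intro tendsto_intros la)
  moreover have "\<forall>\<^sub>F n in F. (l n * a n) * (inverse (a n) * inverse (a n)) = l n / a n"
    using a_pos by eventually_elim (simp add: field_simps)
  ultimately have "((\<lambda>n. l n / a n) \<longlongrightarrow> 0 * (0 * 0)) F" by (rule Lim_transform_eventually)
  then show ?thesis by simp
qed

lemma rescaled_jost_mismatch_tendsto:
  "((\<lambda>n. a n / l n * (\<theta> * jost_mismatch R (W n) (s * (l n / a n))))
    \<longlongrightarrow> s * (\<theta>\<^sup>2 + 1) + 2 * u 0 * u' 0 * (LINT x|lborel. x * V x)) F"
proof (rule Lim_transform_eventually)
  let ?f = "\<lambda>n. jost R (W n) (s * (l n / a n))"
  let ?I = "\<lambda>n. integral {- R..R} (\<lambda>x. V (a n * x) * (u x * ?f n x))"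
  let ?J = "\<lambda>n. integral {- R..R} (\<lambda>x. u x * ?f n x)"
  have k: "((\<lambda>n. s * (l n / a n)) \<longlongrightarrow> 0) F"
    by (rule tendsto_mult_right_zero[OF coupling_ratio_tendsto_zero])
  have f: "uniform_limit {- R..R} ?f u F" by (rule jost_uniform_limit(1)[OF k])
  have fR: "((\<lambda>n. ?f n R) \<longlongrightarrow> \<theta>) F" using tendsto_uniform_limitI[OF f, of R] R u_right(1) by simp
  have "uniform_limit {- R..R} (\<lambda>n x. u x * ?f n x) (\<lambda>x. u x * u x) F"
    by (intro uniform_limit_intros f schr_solution_bounded[OF sol_u])
  then obtain I J where I: "\<And>n. ((\<lambda>x. u x * ?f n x) has_integral I n) {- R..R}" and "(I \<longlongrightarrow> J) F"
    using continuous_on_u_jost F by (rule uniform_limit_integral) (use that in blast)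
  then have J: "(?J \<longlongrightarrow> J) F" by (simp only: integral_unique[OF I])
  have "((\<lambda>n. s + s * \<theta> * ?f n R + (a n)\<^sup>2 * ?I n + s\<^sup>2 * (l n / a n) * ?J n)
    \<longlongrightarrow> s + s * \<theta> * \<theta> + 2 * u 0 * u' 0 * (LINT x|lborel. x * V x) + s\<^sup>2 * 0 * J) F"
    by (intro tendsto_intros fR coupling_ratio_tendsto_zero J dipole_integral_tendsto k)
  then show "((\<lambda>n. s + s * \<theta> * ?f n R + (a n)\<^sup>2 * ?I n + s\<^sup>2 * (l n / a n) * ?J n)
    \<longlongrightarrow> s * (\<theta>\<^sup>2 + 1) + 2 * u 0 * u' 0 * (LINT x|lborel. x * V x)) F"
    by (simp add: power2_eq_square algebra_simps)
  show "\<forall>\<^sub>F n in F. s + s * \<theta> * ?f n R + (a n)\<^sup>2 * ?I n + s\<^sup>2 * (l n / a n) * ?J n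
    = a n / l n * (\<theta> * jost_mismatch R (W n) (s * (l n / a n)))"
    using a_pos l by eventually_elim (rule rescaled_jost_mismatch_eq[symmetric]; simp)
qed

lemma jost_mismatch_zero_branch:
  obtains s where "(s \<longlongrightarrow> threshold_rate) F"
    "\<forall>\<^sub>F n in F. jost_mismatch R (W n) (s n * (l n / a n)) = 0"
proof -
  have pos: "0 < \<theta>\<^sup>2 + 1" by (simp add: add_nonneg_pos)
  define G where "G n s = a n / l n * (\<theta> * jost_mismatch R (W n) (s * (l n / a n)))" for n s
  have "continuous_on UNIV (G n)" for n
    unfolding G_def
    by (intro continuous_intros subset_UNIV
      continuous_on_compose2[OF continuous_on_jost_mismatch[where S = UNIV]]
        bounded_borel_potential less_imp_le[OF R])
  moreover have "((\<lambda>n. G n s) \<longlongrightarrow> (s - threshold_rate) * (\<theta>\<^sup>2 + 1)) F" for s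
  proof -
    have "(s - threshold_rate) * (\<theta>\<^sup>2 + 1) = s * (\<theta>\<^sup>2 + 1) + 2 * u 0 * u' 0 * (LINT x|lborel. x * V x)"
      by (simp add: left_diff_distrib threshold_rate_times_denominator)
    then show ?thesis unfolding G_def by (simp only: rescaled_jost_mismatch_tendsto)
  qed
  moreover have "(s - threshold_rate) * (\<theta>\<^sup>2 + 1) < 0" if "s < threshold_rate" for s
    using that pos by (simp add: mult_neg_pos)
  moreover have "0 < (s - threshold_rate) * (\<theta>\<^sup>2 + 1)" if "threshold_rate < s" for s
    using that pos by simp
  ultimately obtain s where s: "(s \<longlongrightarrow> threshold_rate) F" and zero: "\<forall>\<^sub>F n in F. G n (s n) = 0"
    by (rule zeros_tendsto_sign_change[where c = threshold_rate])
  from zero a_pos l have "\<forall>\<^sub>F n in F. jost_mismatch R (W n) (s n * (l n / a n)) = 0"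
    by eventually_elim (use theta_nonzero in \<open>simp add: G_def\<close>)
  with s show ?thesis by (rule that)
qed

lemma threshold_eigenvalue_branch:
  assumes neg: "u 0 * u' 0 * (LINT x|lborel. x * V x) < 0"
  obtains s where "(s \<longlongrightarrow> threshold_rate) F"
    "\<forall>\<^sub>F n in F. 0 < s n \<and> schr_eigenvalue (W n) (- (s n * (l n / a n))\<^sup>2)"
proof -
  have "0 < threshold_rate * (\<theta>\<^sup>2 + 1)"
    unfolding threshold_rate_times_denominator using neg by (simp add: mult.assoc)
  then have rate: "0 < threshold_rate" by (rule zero_less_mult_pos2) (simp add: add_nonneg_pos)
  obtain s where s: "(s \<longlongrightarrow> threshold_rate) F"
    and zero: "\<forall>\<^sub>F n in F. jost_mismatch R (W n) (s n * (l n / a n)) = 0"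
    by (rule jost_mismatch_zero_branch)
  have "\<forall>\<^sub>F n in F. 1 \<le> a n" using a unfolding filterlim_at_top by blast
  with order_tendstoD(1)[OF s rate] l zero
  have "\<forall>\<^sub>F n in F. 0 < s n \<and> schr_eigenvalue (W n) (- (s n * (l n / a n))\<^sup>2)"
  proof eventually_elim
    case (elim n)
    then have "0 < s n * (l n / a n)" by simp
    with elim show ?case
      using jost_mismatch_zero_imp_schr_eigenvalue[OF bounded_borel_potential
          potential_supp[of "a n"] R] by blast
  qed
  with s show ?thesis by (rule that)
qed

end

lemma half_bound_dipole_representative:
  assumes U: "Linf_compact U" and V: "Linf_compact V" and hbs: "half_bound_state U u"
    and at_bot: "(u \<longlongrightarrow> 1) at_bot" and at_top: "(u \<longlongrightarrow> \<theta>) at_top" and mean: "(LINT x|lborel. V x) = 0"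
  obtains U0 V0 R where "half_bound_dipole U0 u (deriv u) R \<theta> V0"
    "AE x in lborel. U x = U0 x" "AE x in lborel. V x = V0 x"
proof -
  obtain U0 R1 where U0: "bounded_borel U0" "\<And>x. R1 < \<bar>x\<bar> \<Longrightarrow> U0 x = 0" "AE x in lborel. U x = U0 x"
    using Linf_compact_representative[OF U] by blast
  obtain V0 R2 where V0: "bounded_borel V0" "\<And>x. R2 < \<bar>x\<bar> \<Longrightarrow> V0 x = 0" "AE x in lborel. V x = V0 x"
    using Linf_compact_representative[OF V] by blast
  define R where "R = max 0 (max R1 R2) + 1"
  have R: "0 < R" "R1 < R" "R2 < R" by (auto simp: R_def)
  have sol: "schr_solution U0 UNIV u (deriv u)"
    by (rule half_bound_state_imp_schr_solution[OF hbs U0(3)])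
  have supp: "U0 x = 0" if "R \<le> \<bar>x\<bar>" for x using U0(2) R(2) that by simp
  have bdd: "bounded (range u)" using hbs by (simp add: half_bound_state_def)
  have "V \<in> borel_measurable lborel" using V by (simp add: Linf_compact_def)
  then have "(LINT x|lborel. V0 x) = (LINT x|lborel. V x)"
    using V0(1,3) by (intro integral_cong_AE) (auto simp: bounded_borel_measurable)
  then have "half_bound_dipole U0 u (deriv u) R \<theta> V0"
    using U0(1) V0(1,2) R supp mean schr_solution_subset[OF sol subset_UNIV]
      half_bound_state_boundary_values[OF sol supp less_imp_le[OF R(1)] bdd at_bot at_top]
    by unfold_locales auto
  then show ?thesis using U0(3) V0(3) by (rule that)
qed

lemma threshold_eigenvalue_asymptotics:
  assumes U: "Linf_compact U" and V: "Linf_compact V" and hbs: "half_bound_state U u"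
    and at_bot: "(u \<longlongrightarrow> 1) at_bot" and at_top: "(u \<longlongrightarrow> \<theta>) at_top" and mean: "(LINT x|lborel. V x) = 0"
    and sign: "u 0 * deriv u 0 * (LINT x|lborel. x * V x) < 0"
    and F: "F \<noteq> bot" and a: "filterlim a at_top F" and la: "((\<lambda>n. l n * a n) \<longlongrightarrow> 0) F"
    and l: "\<forall>\<^sub>F n in F. 0 < l n"
  obtains s where "(s \<longlongrightarrow> - (2 * u 0 * deriv u 0 / (\<theta>\<^sup>2 + 1) * (LINT x|lborel. x * V x))) F"
    "\<forall>\<^sub>F n in F. 0 < s n
      \<and> schr_eigenvalue (\<lambda>x. U x + l n * a n * V (a n * x)) (- (s n * (l n / a n))\<^sup>2)"
proof -
  obtain U0 V0 R where "half_bound_dipole U0 u (deriv u) R \<theta> V0"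
    and U0: "AE x in lborel. U x = U0 x" and V0: "AE x in lborel. V x = V0 x"
    by (rule half_bound_dipole_representative[OF U V hbs at_bot at_top mean])
  then interpret rep: half_bound_dipole_limit U0 u "deriv u" R \<theta> V0 F l a
    using F a la l by (intro half_bound_dipole_limit.intro half_bound_dipole_limit_axioms.intro)
  have meas: "V \<in> borel_measurable borel" "V0 \<in> borel_measurable borel"
    using V bounded_borel_measurable[OF rep.V] by (simp_all add: Linf_compact_def)
  have moment: "(LINT x|lborel. x * V0 x) = (LINT x|lborel. x * V x)"
    using meas V0 by (intro integral_cong_AE) auto
  obtain s where s: "(s \<longlongrightarrow> rep.threshold_rate) F"
    "\<forall>\<^sub>F n in F. 0 < s n \<and> schr_eigenvalue (rep.W n) (- (s n * (l n / a n))\<^sup>2)"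
    using rep.threshold_eigenvalue_branch sign[folded moment] .
  have "AE x in lborel. rep.W n x = U x + l n * a n * V (a n * x)" if "0 < a n" for n
  proof -
    have "AE x in lborel. V (0 + a n * x) = V0 (0 + a n * x)"
      by (rule AE_borel_affine) (use that meas V0 in auto)
    with U0 show ?thesis by eventually_elim (simp add: rep.potential_def)
  qed
  note cong = schr_eigenvalue_cong_AE[OF _ this]
  from s(2) rep.a_pos have "\<forall>\<^sub>F n in F. 0 < s n \<and>
      schr_eigenvalue (\<lambda>x. U x + l n * a n * V (a n * x)) (- (s n * (l n / a n))\<^sup>2)"
    by eventually_elim (auto intro: cong)
  with s(1)[unfolded rep.threshold_rate_def moment] show ?thesis by (rule that)
qed

lemma smallo_powr_imp_mult_tendsto_zero:
  fixes f :: "real \<Rightarrow> real"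
  assumes f: "f \<in> o[at_right 0](\<lambda>x. x powr - p)" and p: "p \<le> 1"
  shows "((\<lambda>x. x * f x) \<longlongrightarrow> 0) (at_right 0)"
proof (rule Lim_null_comparison)
  show "((\<lambda>x. norm (f x / x powr - p)) \<longlongrightarrow> 0) (at_right 0)"
    using smalloD_tendsto[OF f] by (rule tendsto_norm_zero)
  have "\<forall>\<^sub>F x in at_right (0::real). 0 < x \<and> x < 1"
    by (rule eventually_at_rightI[of 0 1]) auto
  then show "\<forall>\<^sub>F x in at_right 0. norm (x * f x) \<le> norm (f x / x powr - p)"
  proof eventually_elim
    case (elim x)
    then have "x powr (1 - p) \<le> 1" using p by (intro powr_le1) auto
    then have "x * x powr - p \<le> 1" using elim powr_mult_base[of x "- p"] by simp
    then have "x \<le> 1 / x powr - p" using elim by (simp add: pos_le_divide_eq)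
    from mult_right_mono[OF this, of "\<bar>f x\<bar>"] show ?case using elim by (simp add: abs_mult)
  qed
qed

theorem theorem3:
  fixes U V :: "real \<Rightarrow> real" and alpha :: "real \<Rightarrow> real" and u :: "real \<Rightarrow> real" and \<theta> :: real
  assumes U: "Linf_compact U" and V: "Linf_compact V"
    and alpha_pos: "\<forall>l::real. l > 0 \<longrightarrow> alpha l > 0"
    and alpha_inf: "filterlim alpha at_top (at_right 0)"
    and hbs: "half_bound_state U u" and u_left: "(u \<longlongrightarrow> 1) at_bot"
    and theta: "(u \<longlongrightarrow> \<theta>) at_top"
    and V0: "(LINT x|lborel. V x) = 0"
    and sign: "u 0 * deriv u 0 * (LINT x|lborel. x * V x) < 0"
    and alpha_small: "alpha \<in> o[at_right 0](\<lambda>l. l powr (-1/3))"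
  shows "\<exists>e :: real \<Rightarrow> real.
     (\<forall>\<^sub>F l in at_right 0. e l < 0 \<and>
         schr_eigenvalue (\<lambda>x. U x + l * alpha l * V (alpha l * x)) (e l)) \<and>
     (e \<longlongrightarrow> 0) (at_right 0) \<and>
     (\<exists>r :: real \<Rightarrow> real. (r \<longlongrightarrow> 0) (at_right 0) \<and>
        (\<forall>\<^sub>F l in at_right 0. e l = - (l\<^sup>2 / (alpha l)\<^sup>2) *
           ((2 * u 0 * deriv u 0 / (\<theta>\<^sup>2 + 1) * (LINT x|lborel. x * V x))\<^sup>2 + r l)))"
proof -
  let ?c = "- (2 * u 0 * deriv u 0 / (\<theta>\<^sup>2 + 1) * (LINT x|lborel. x * V x))"
  have small: "((\<lambda>l. l * alpha l) \<longlongrightarrow> 0) (at_right 0)"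
    using alpha_small by (intro smallo_powr_imp_mult_tendsto_zero[of _ "1/3"]) simp_all
  obtain s where s: "(s \<longlongrightarrow> ?c) (at_right 0)" and eigenvalue: "\<forall>\<^sub>F l in at_right 0. 0 < s l \<and>
      schr_eigenvalue (\<lambda>x. U x + l * alpha l * V (alpha l * x)) (- (s l * (l / alpha l))\<^sup>2)"
    by (rule threshold_eigenvalue_asymptotics[OF U V hbs u_left theta V0 sign _ alpha_inf small])
      (auto simp: eventually_at_right_less)
  have "((\<lambda>l. l / alpha l) \<longlongrightarrow> 0) (at_right 0)"
    by (rule tendsto_divide_0[OF tendsto_ident_at filterlim_at_top_imp_at_infinity[OF alpha_inf]])
  then have "((\<lambda>l. - (s l * (l / alpha l))\<^sup>2) \<longlongrightarrow> - (?c * 0)\<^sup>2) (at_right 0)"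
    by (intro tendsto_intros s)
  moreover have "((\<lambda>l. (s l)\<^sup>2 - ?c\<^sup>2) \<longlongrightarrow> ?c\<^sup>2 - ?c\<^sup>2) (at_right 0)" by (intro tendsto_intros s)
  moreover have "- (s l * (l / alpha l))\<^sup>2 = - (l\<^sup>2 / (alpha l)\<^sup>2) * (?c\<^sup>2 + ((s l)\<^sup>2 - ?c\<^sup>2))" for l
    by (simp add: power_mult_distrib power_divide)
  moreover have "\<forall>\<^sub>F l in at_right 0. - (s l * (l / alpha l))\<^sup>2 < 0"
    using eigenvalue eventually_at_right_less[of 0] by eventually_elim (use alpha_pos in fastforce)
  ultimately show ?thesis
    using eigenvalue
    by (intro exI[of _ "\<lambda>l. - (s l * (l / alpha l))\<^sup>2"] exI[of _ "\<lambda>l. (s l)\<^sup>2 - ?c\<^sup>2"] conjI)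
      (auto elim: eventually_elim2)
qed

end
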